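(* Let $p\geq3$ and $\lambda=\lambda_p=2\cos(\pi/p)$. Suppose that $\alpha$ is a $G_p$-simple number with Hecke conjugate $\alpha'$. Then $S^n\alpha=\alpha+n\lambda$, with $n=-\lfloor\alpha'/\lambda\rfloor$, is a $G_p$-reduced number. Moreover, the set of $G_p$-simple numbers equals $$\mathcal{Z}=\left\{S^{-i}\beta=\beta-i\lambda \;\middle|\; \beta \text{ is } G_p\text{-reduced},\ 1\le i\le \lfloor\beta/\lambda\rfloor\right\}.$$
   Context: Let $S=\begin{pmatrix}1&\lambda\\0&1\end{pmatrix}$, $T=\begin{pmatrix}0&-1\\1&0\end{pmatrix}$, $G_p=\langle S,T\rangle/\{\pm I\}$ acting by linear fractional transformations. A hyperbolic fixed point is a real number fixed by an element of $G_p$ with $|{\rm trace}|>2$; its Hecke conjugate is the other fixed point of the elements of its stabilizer. For a $\lambda$-BQF $Q=[A,B,C]$ ($A,B,C\in\mathbb{Z}[\lambda]$, $D=B^2-4AC>0$), $\alpha_Q=\frac{-B+\sqrt D}{2A}$. Hyperbolic forms are those of the form $Q_\alpha=[c,d-a,-b]$, $\alpha$ a hyperbolic fixed point and $\begin{pmatrix}a&b\\c&d\end{pmatrix}$ a generator of its stabilizer chosen up to inversion so that $\alpha=\frac{a-d+\sqrt{(a+d)^2-4}}{2c}$. A hyperbolic form $[A,B,C]$ is $G_p$-simple if $A>0>C$, and a $G_p$-simple number is $\alpha_Q$ for a $G_p$-simple form $Q$. The $\lambda$-continued fraction of real $x$: $x_0=x$, $r_j=\lfloor x_j/\lambda\rfloor+1$,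 $x_{j+1}=\frac1{r_j\lambda-x_j}$. A real number is $G_p$-reduced if its $\lambda$-continued fraction is purely periodic with period other than $(2,1,\dots,1)$ ($p-3$ ones). *)

theory Defs
  imports Complex_Main
begin

definition lam :: "nat \<Rightarrow> real" where
  "lam p = 2 * cos (pi / real p)"

type_synonym mat2 = "real \<times> real \<times> real \<times> real"

fun mmul :: "mat2 \<Rightarrow> mat2 \<Rightarrow> mat2" where
  "mmul (a,b,c,d) (a',b',c',d') = (a*a'+b*c', a*b'+b*d', c*a'+d*c', c*b'+d*d')"

definition mid :: mat2 where "mid = (1,0,0,1)"

fun mneg :: "mat2 \<Rightarrow> mat2" where
  "mneg (a,b,c,d) = (-a,-b,-c,-d)"

fun minv :: "mat2 \<Rightarrow> mat2" where
  "minv (a,b,c,d) = (d,-b,-c,a)"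

fun mtrace :: "mat2 \<Rightarrow> real" where
  "mtrace (a,b,c,d) = a + d"

definition mpow :: "mat2 \<Rightarrow> int \<Rightarrow> mat2" where
  "mpow M k = (if 0 \<le> k then ((mmul M) ^^ nat k) mid else ((mmul (minv M)) ^^ nat (-k)) mid)"

definition matS :: "nat \<Rightarrow> mat2" where "matS p = (1, lam p, 0, 1)"
definition matSinv :: "nat \<Rightarrow> mat2" where "matSinv p = (1, - lam p, 0, 1)"
definition matT :: mat2 where "matT = (0, -1, 1, 0)"
definition matTinv :: mat2 where "matTinv = (0, 1, -1, 0)"

text \<open>The matrix group generated by S and T (words in S, T and their inverses).
  G_p is its quotient by {+I,-I}; since -I = T^2 lies in it, all notions below
  (action, |trace|, stabilizers up to sign) are insensitive to the sign.\<close>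
inductive_set Gp :: "nat \<Rightarrow> mat2 set" for p :: nat where
  Gp_id: "mid \<in> Gp p"
| Gp_S: "M \<in> Gp p \<Longrightarrow> mmul (matS p) M \<in> Gp p"
| Gp_Sinv: "M \<in> Gp p \<Longrightarrow> mmul (matSinv p) M \<in> Gp p"
| Gp_T: "M \<in> Gp p \<Longrightarrow> mmul matT M \<in> Gp p"
| Gp_Tinv: "M \<in> Gp p \<Longrightarrow> mmul matTinv M \<in> Gp p"

fun moeb :: "mat2 \<Rightarrow> real \<Rightarrow> real" where
  "moeb (a,b,c,d) x = (a*x + b) / (c*x + d)"

fun fixes_pt :: "mat2 \<Rightarrow> real \<Rightarrow> bool" where
  "fixes_pt (a,b,c,d) x \<longleftrightarrow> c*x + d \<noteq> 0 \<and> moeb (a,b,c,d) x = x"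

definition hyp_fixed_point :: "nat \<Rightarrow> real \<Rightarrow> bool" where
  "hyp_fixed_point p \<alpha> \<longleftrightarrow> (\<exists>M \<in> Gp p. \<bar>mtrace M\<bar> > 2 \<and> fixes_pt M \<alpha>)"

definition hecke_conj :: "nat \<Rightarrow> real \<Rightarrow> real" where
  "hecke_conj p \<alpha> = (THE \<beta>. \<beta> \<noteq> \<alpha> \<and>
      (\<exists>M \<in> Gp p. \<bar>mtrace M\<bar> > 2 \<and> fixes_pt M \<alpha> \<and> fixes_pt M \<beta>))"

definition stab_generator :: "nat \<Rightarrow> real \<Rightarrow> mat2 \<Rightarrow> bool" where
  "stab_generator p \<alpha> M \<longleftrightarrow> M \<in> Gp p \<and> fixes_pt M \<alpha> \<and>
     (\<forall>N \<in> Gp p. fixes_pt N \<alpha> \<longrightarrow> (\<exists>k::int. N = mpow M k \<or> N = mneg (mpow M k)))"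

definition Zlam :: "nat \<Rightarrow> real set" where
  "Zlam p = {x. \<exists>cs :: int list. x = (\<Sum>i<length cs. of_int (cs ! i) * lam p ^ i)}"

type_synonym bqf = "real \<times> real \<times> real"

fun lambda_bqf :: "nat \<Rightarrow> bqf \<Rightarrow> bool" where
  "lambda_bqf p (A,B,C) \<longleftrightarrow> A \<in> Zlam p \<and> B \<in> Zlam p \<and> C \<in> Zlam p \<and> B^2 - 4*A*C > 0"

fun alpha_Q :: "bqf \<Rightarrow> real" where
  "alpha_Q (A,B,C) = (- B + sqrt (B^2 - 4*A*C)) / (2*A)"

definition hyperbolic_form :: "nat \<Rightarrow> bqf \<Rightarrow> bool" where
  "hyperbolic_form p Q \<longleftrightarrow> (\<exists>\<alpha> a b c d. hyp_fixed_point p \<alpha> \<and> stab_generator p \<alpha> (a,b,c,d) \<and>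
      \<alpha> = (a - d + sqrt ((a+d)^2 - 4)) / (2*c) \<and> Q = (c, d - a, - b))"

fun Gp_simple_form :: "nat \<Rightarrow> bqf \<Rightarrow> bool" where
  "Gp_simple_form p (A,B,C) \<longleftrightarrow> lambda_bqf p (A,B,C) \<and> hyperbolic_form p (A,B,C) \<and> A > 0 \<and> C < 0"

definition Gp_simple_number :: "nat \<Rightarrow> real \<Rightarrow> bool" where
  "Gp_simple_number p \<alpha> \<longleftrightarrow> (\<exists>Q. Gp_simple_form p Q \<and> \<alpha> = alpha_Q Q)"

fun cf_x :: "nat \<Rightarrow> real \<Rightarrow> nat \<Rightarrow> real" where
  "cf_x p x 0 = x"
| "cf_x p x (Suc j) = 1 / (of_int (\<lfloor>cf_x p x j / lam p\<rfloor> + 1) * lam p - cf_x p x j)"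

definition cf_r :: "nat \<Rightarrow> real \<Rightarrow> nat \<Rightarrow> int" where
  "cf_r p x j = \<lfloor>cf_x p x j / lam p\<rfloor> + 1"

definition Gp_reduced :: "nat \<Rightarrow> real \<Rightarrow> bool" where
  "Gp_reduced p x \<longleftrightarrow> (\<exists>k>0. \<forall>j. cf_r p x (j + k) = cf_r p x j) \<and>
     \<not> (\<forall>j. cf_r p x j = (if j mod (p - 2) = 0 then 2 else 1))"

end

theory Submission
  imports Defs
begin

text \<open>
  Put \<open>s\<^sub>k = sin (k \<pi>/p) / sin (\<pi>/p)\<close> and let \<open>W\<^sub>k\<close> be the matrix with rows
  \<open>(s\<^sub>k, s\<^sub>k\<^sub>+\<^sub>1)\<close> and \<open>(s\<^sub>k\<^sub>-\<^sub>1, s\<^sub>k)\<close>, so that \<open>W\<^sub>1 = S\<close>, \<open>S T W\<^sub>k = W\<^sub>k\<^sub>+\<^sub>1\<close>,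
  \<open>W\<^sub>p = T\<close>. For \<open>1 \<le> k < p\<close> the \<open>W\<^sub>k\<close> have nonnegative entries and map the positive half-line
  onto disjoint intervals, and every element of the group is a word in them up to powers of \<open>T\<close> on
  either side. Comparing signs of entries, the simple numbers are exactly the positive fixed points
  of nonempty words, and a shortest such word generates the stabilizer.

  If \<open>x - \<lambda> = W\<^sub>1\<^sup>a W\<^sub>m \<eta>\<close> with \<open>m \<noteq> 1\<close> and \<open>\<eta> \<ge> 0\<close>, then the \<open>\<lambda>\<close>-continued fraction of \<open>x\<close> is
  \<open>a + 2\<close> followed by \<open>m - 2\<close> ones and then by that of \<open>\<eta> + \<lambda>\<close>. Hence the reduced numbers
  \<open>\<beta> \<ge> \<lambda>\<close> correspond to the positive fixed points \<open>\<beta> - \<lambda>\<close> of words whose last letter is not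
  \<open>W\<^sub>1\<close> (the excluded period belongs to the fixed point 0 of \<open>W\<^sub>p\<^sub>-\<^sub>1\<close>), and moving letters
  \<open>W\<^sub>1\<close> cyclically between the ends of a word translates its fixed point by multiples of \<open>\<lambda>\<close>.
\<close>

section \<open>Two-by-two matrices and their fixed points\<close>

fun mdet :: "mat2 \<Rightarrow> real" where "mdet (a,b,c,d) = a*d - b*c"
fun mden :: "mat2 \<Rightarrow> real \<Rightarrow> real" where "mden (a,b,c,d) x = c*x + d"
fun mtransp :: "mat2 \<Rightarrow> mat2" where "mtransp (a,b,c,d) = (a,c,b,d)"

lemma mmul_assoc: "mmul (mmul A B) C = mmul A (mmul B C)"
  by (cases A; cases B; cases C) (simp add: algebra_simps)

lemma mmul_mid [simp]: "mmul mid A = A" "mmul A mid = A"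
  by (cases A; simp add: mid_def)+

lemma mmul_mneg [simp]: "mmul (mneg A) B = mneg (mmul A B)" "mmul A (mneg B) = mneg (mmul A B)"
  by (cases A; cases B; simp)+

lemma mneg_mneg [simp]: "mneg (mneg A) = A"
  by (cases A) simp

lemma mdet_mmul [simp]: "mdet (mmul A B) = mdet A * mdet B"
  by (cases A; cases B) (simp add: algebra_simps)

lemma mmul_minv: "mdet A = 1 \<Longrightarrow> mmul A (minv A) = mid" "mdet A = 1 \<Longrightarrow> mmul (minv A) A = mid"
  by (cases A; simp add: mid_def algebra_simps)+

lemma mtransp_mmul: "mtransp (mmul A B) = mmul (mtransp B) (mtransp A)"
  by (cases A; cases B) (simp add: algebra_simps)

text \<open>The cocycle rule for the denominator. It is tracked separately because division by zero
  yields 0, so \<open>moeb\<close> composes reliably only where the inner denominator is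
  nonzero.\<close>

lemma mden_mmul:
  assumes "mden B x \<noteq> 0"
  shows "mden (mmul A B) x = mden A (moeb B x) * mden B x"
  using assms by (cases A; cases B) (simp add: field_simps)

lemma moeb_mmul:
  assumes "mden B x \<noteq> 0"
  shows "moeb (mmul A B) x = moeb A (moeb B x)"
proof -
  obtain a b c d a' b' c' d' where AB: "A = (a,b,c,d)" "B = (a',b',c',d')"
    by (cases A; cases B) auto
  define q where "q = c' * x + d'"
  have q: "q \<noteq> 0" using assms AB by (simp add: q_def)
  have n: "a * (a' * x + b') + b * q = (a*a'+b*c') * x + (a*b'+b*d')"
    and m: "c * (a' * x + b') + d * q = (c*a'+d*c') * x + (c*b'+d*d')"
    by (simp_all add: q_def algebra_simps)
  have "moeb A (moeb B x) = (a * ((a'*x+b')/q) + b) / (c * ((a'*x+b')/q) + d)"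
    by (simp add: AB q_def)
  also have "\<dots> = ((a * (a' * x + b') + b * q) / q) / ((c * (a' * x + b') + d * q) / q)"
  proof -
    have "u * (v / q) + w = (u * v + w * q) / q" for u v w :: real
      using q by (simp add: field_simps)
    then show ?thesis by simp
  qed
  also have "\<dots> = (a * (a' * x + b') + b * q) / (c * (a' * x + b') + d * q)"
    using q by simp
  finally show ?thesis by (simp add: AB n m)
qed

lemma fixes_pt_iff: "fixes_pt M x \<longleftrightarrow> mden M x \<noteq> 0 \<and> moeb M x = x"
  by (cases M) simp

lemma fixes_pt_mneg [simp]: "fixes_pt (mneg M) x \<longleftrightarrow> fixes_pt M x"
proof (cases M)
  case (fields a b c d)
  have "(- a * x + - b) / (- c * x + - d) = (- (a*x+b)) / (- (c*x+d))"
    by (simp add: algebra_simps)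
  also have "\<dots> = (a*x+b) / (c*x+d)" by (rule minus_divide_divide)
  finally show ?thesis using fields by auto
qed

lemma fixes_pt_quadratic:
  assumes "fixes_pt (a,b,c,d) x"
  shows "c*x*x + d*x - a*x - b = 0"
  using assms by (auto simp: field_simps)

text \<open>Both factors are eigenvalues: \<open>c*x + d\<close> belongs to the eigenvector
  \<open>(x, 1)\<close>, and the trace minus it is \<open>a - c*x\<close>. Their product is the
  determinant.\<close>

lemma fixes_pt_inverse:
  assumes "fixes_pt (a,b,c,d) x" "a*d - b*c = 1"
  shows "(a - c*x) * (c*x+d) = 1"
proof -
  have "(a - c*x) * (c*x+d) = (a*d - b*c) - c * (c*x*x + d*x - a*x - b)"
    by (simp add: algebra_simps)
  with assms fixes_pt_quadratic show ?thesis by simp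
qed

text \<open>Vieta: \<open>(a-d)/c\<close> is the sum of the roots of the fixed point equation. The
  denominator at the second root is the other eigenvalue \<open>a - c*x\<close>, hence
  nonzero.\<close>

lemma fixes_pt_conj:
  assumes M: "fixes_pt (a,b,c,d) x" "a*d - b*c = 1" and "c \<noteq> 0"
  shows "fixes_pt (a,b,c,d) ((a-d)/c - x)"
proof -
  define y where "y = (a-d)/c - x"
  have cy: "c * y = a - d - c*x" using \<open>c \<noteq> 0\<close> by (simp add: y_def field_simps)
  have nz: "a - c*x \<noteq> 0" using fixes_pt_inverse[OF M] by auto
  have den: "c * y + d = a - c*x" by (simp add: cy)
  have "c * (y * (c * y + d) - (a * y + b)) = (c * y) * (c * y + d) - a * (c * y) - b*c"
    by (simp add: algebra_simps)
  also have "\<dots> = c * (c*x*x + d*x - a*x - b)"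
    unfolding cy by (simp add: algebra_simps)
  also have "\<dots> = 0" using fixes_pt_quadratic[OF M(1)] by simp
  finally have "y * (c * y + d) = a * y + b" using \<open>c \<noteq> 0\<close> by simp
  then have "moeb (a,b,c,d) y = y" using nz den by (simp add: divide_eq_eq)
  with nz den show ?thesis by (simp only: fixes_pt.simps y_def) simp
qed

lemma fixes_pt_two:
  assumes x: "fixes_pt (a,b,c,d) x" and y: "fixes_pt (a,b,c,d) y" and "c \<noteq> 0" "y \<noteq> x"
  shows "y = (a-d)/c - x"
proof -
  have "(y - x) * (c * (x + y) + d - a) = 0"
    using fixes_pt_quadratic[OF x] fixes_pt_quadratic[OF y] by (simp add: algebra_simps)
  with \<open>y \<noteq> x\<close> have "c * (x + y) + d - a = 0" by simp
  with \<open>c \<noteq> 0\<close> show ?thesis by (simp add: field_simps)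
qed

lemma fixes_pt_mmul: "fixes_pt A x \<Longrightarrow> fixes_pt B x \<Longrightarrow> fixes_pt (mmul A B) x"
  by (simp add: fixes_pt_iff mden_mmul moeb_mmul)

lemma fixes_pt_minv:
  assumes "fixes_pt M x" "mdet M = 1"
  shows "fixes_pt (minv M) x"
proof -
  obtain a b c d where M: "M = (a,b,c,d)" by (cases M) auto
  have i: "(a - c*x) * (c*x+d) = 1" using assms M fixes_pt_inverse by simp
  have nz: "a - c*x \<noteq> 0" using i by auto
  have "c*x*x + d*x - a*x - b = 0" using assms M fixes_pt_quadratic by simp
  then have "d * x - b = x * (a - c*x)" by (simp add: algebra_simps)
  with nz show ?thesis by (simp add: M)
qed

lemma fixes_pt_cancel_right:
  assumes "fixes_pt (mmul N V) x" "fixes_pt V x"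
  shows "fixes_pt N x"
  using assms by (simp add: fixes_pt_iff mden_mmul moeb_mmul)

section \<open>Powers of a matrix\<close>

definition natpow :: "mat2 \<Rightarrow> nat \<Rightarrow> mat2" where
  "natpow M n = ((mmul M) ^^ n) mid"

lemma natpow_0 [simp]: "natpow M 0 = mid"
  and natpow_Suc [simp]: "natpow M (Suc n) = mmul M (natpow M n)"
  by (simp_all add: natpow_def)

lemma natpow_add: "natpow M (m + n) = mmul (natpow M m) (natpow M n)"
  by (induction m) (simp_all add: mmul_assoc)

lemma natpow_minv:
  assumes "mdet M = 1"
  shows "mmul (natpow M n) (natpow (minv M) n) = mid"
proof (induction n)
  case (Suc n)
  have "natpow (minv M) (Suc n) = mmul (natpow (minv M) n) (minv M)"
    using natpow_add[of "minv M" n 1] by simp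
  then have "mmul (natpow M (Suc n)) (natpow (minv M) (Suc n)) =
      mmul M (mmul (mmul (natpow M n) (natpow (minv M) n)) (minv M))"
    by (simp add: mmul_assoc)
  with Suc assms show ?case by (simp add: mmul_minv)
qed simp

lemma mpow_eqI:
  assumes det: "mdet M = 1" and eq: "mmul N (natpow M l) = natpow M i"
  shows "N = mpow M (int i - int l)"
proof (cases "l \<le> i")
  case True
  then obtain q where q: "i = q + l" by (metis add.commute le_add_diff_inverse)
  have "N = mmul (mmul N (natpow M l)) (natpow (minv M) l)"
    using natpow_minv[OF det, of l] by (simp add: mmul_assoc)
  also have "\<dots> = mmul (natpow M q) (mmul (natpow M l) (natpow (minv M) l))"
    by (simp add: eq q natpow_add mmul_assoc)
  also have "\<dots> = natpow M q" by (simp add: natpow_minv[OF det])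
  finally show ?thesis by (simp add: q mpow_def natpow_def)
next
  case False
  then obtain q where q: "l = q + i" "q > 0" by (metis add.commute less_imp_add_positive linorder_not_less)
  have "mmul N (natpow M q) = mmul (mmul N (natpow M l)) (natpow (minv M) i)"
    using natpow_minv[OF det, of i] by (simp add: q natpow_add mmul_assoc)
  also have "\<dots> = mid" using natpow_minv[OF det, of i] by (simp add: eq)
  finally have "mmul N (natpow M q) = mid" .
  moreover have "N = mmul (mmul N (natpow M q)) (natpow (minv M) q)"
    using natpow_minv[OF det, of q] by (simp add: mmul_assoc)
  ultimately have "N = natpow (minv M) q" by simp
  with q show ?thesis by (simp add: mpow_def natpow_def)
qed

section \<open>The matrix group and the ring generated by \<open>lam p\<close>\<close>

lemma Gp_mmul: "M \<in> Gp p \<Longrightarrow> N \<in> Gp p \<Longrightarrow> mmul M N \<in> Gp p"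
  by (induction rule: Gp.induct) (simp_all add: mmul_assoc Gp.intros)

lemma mdet_Gp: "M \<in> Gp p \<Longrightarrow> mdet M = 1"
  by (induction rule: Gp.induct)
     (simp_all add: mid_def matS_def matSinv_def matT_def matTinv_def)

lemma Zlam_0: "0 \<in> Zlam p"
  unfolding Zlam_def by (rule CollectI, rule exI[of _ "[]"]) simp

lemma Zlam_1: "1 \<in> Zlam p"
  unfolding Zlam_def by (rule CollectI, rule exI[of _ "[1]"]) simp

lemma Zlam_lam: assumes "x \<in> Zlam p" shows "lam p * x \<in> Zlam p"
proof -
  obtain cs :: "int list" where x: "x = (\<Sum>i<length cs. of_int (cs ! i) * lam p ^ i)"
    using assms by (auto simp: Zlam_def)
  have "(\<Sum>i<length (0 # cs). of_int ((0 # cs) ! i) * lam p ^ i) = lam p * x"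
    by (simp only: list.size sum.lessThan_Suc_shift x sum_distrib_left add_0_right add_Suc_right)
       (simp add: mult_ac)
  then show ?thesis unfolding Zlam_def by (intro CollectI exI[of _ "0 # cs"]) (rule sym)
qed

lemma Zlam_uminus: assumes "x \<in> Zlam p" shows "- x \<in> Zlam p"
proof -
  obtain cs :: "int list" where x: "x = (\<Sum>i<length cs. of_int (cs ! i) * lam p ^ i)"
    using assms by (auto simp: Zlam_def)
  have "- x = (\<Sum>i<length (map uminus cs). of_int (map uminus cs ! i) * lam p ^ i)"
    by (simp add: x sum_negf[symmetric])
  then show ?thesis unfolding Zlam_def by blast
qed

lemma Zlam_add: assumes "x \<in> Zlam p" "y \<in> Zlam p" shows "x + y \<in> Zlam p"
proof -
  obtain cs ds :: "int list"
    where x: "x = (\<Sum>i<length cs. of_int (cs ! i) * lam p ^ i)"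
      and y: "y = (\<Sum>i<length ds. of_int (ds ! i) * lam p ^ i)"
    using assms by (auto simp: Zlam_def)
  \<comment> \<open>Padding with zeros to the sum of the lengths avoids a case split on which list
    is longer.\<close>
  define n where "n = length cs + length ds"
  define c where "c es i = (if i < length es then es ! i else 0)" for es :: "int list" and i
  have ext: "(\<Sum>i<length es. of_int (es ! i) * lam p ^ i) = (\<Sum>i<n. of_int (c es i) * lam p ^ i)"
    if "length es \<le> n" for es
    by (rule sum.mono_neutral_cong_left) (use that in \<open>auto simp: c_def\<close>)
  have "x + y = (\<Sum>i<n. of_int (c cs i) * lam p ^ i) + (\<Sum>i<n. of_int (c ds i) * lam p ^ i)"
    unfolding x y by (subst (1 2) ext) (simp_all add: n_def)
  also have "\<dots> = (\<Sum>i<n. of_int (c cs i + c ds i) * lam p ^ i)"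
    by (simp add: sum.distrib[symmetric] algebra_simps)
  finally have "x + y = (\<Sum>i<length (map (\<lambda>i. c cs i + c ds i) [0..<n]).
      of_int (map (\<lambda>i. c cs i + c ds i) [0..<n] ! i) * lam p ^ i)" by simp
  then show ?thesis unfolding Zlam_def by blast
qed

lemma Zlam_diff: "x \<in> Zlam p \<Longrightarrow> y \<in> Zlam p \<Longrightarrow> x - y \<in> Zlam p"
  using Zlam_add[of x p "- y"] Zlam_uminus[of y p] by simp

lemma Gp_Zlam:
  "M \<in> Gp p \<Longrightarrow> (case M of (a,b,c,d) \<Rightarrow> a \<in> Zlam p \<and> b \<in> Zlam p \<and> c \<in> Zlam p \<and> d \<in> Zlam p)"
  by (induction rule: Gp.induct)
     (auto simp: mid_def matS_def matSinv_def matT_def matTinv_def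
        simp flip: add_uminus_conv_diff
        intro: Zlam_0 Zlam_1 Zlam_add Zlam_uminus Zlam_lam Zlam_add[OF _ Zlam_lam]
          Zlam_add[OF _ Zlam_uminus[OF Zlam_lam]])

section \<open>Words in the letters and the Hecke group\<close>

text \<open>Diagonal entries at least 1, rather than merely nonnegative, keep every denominator
  positive on the closed half-line, 0 included, and bound the trace from below.\<close>

fun wpos :: "mat2 \<Rightarrow> bool" where
  "wpos (a,b,c,d) \<longleftrightarrow> a \<ge> 1 \<and> d \<ge> 1 \<and> b \<ge> 0 \<and> c \<ge> 0 \<and> a*d - b*c = 1"

lemma wpos_mid: "wpos mid"
  by (simp add: mid_def)

lemma wpos_mdet: "wpos M \<Longrightarrow> mdet M = 1"
  by (cases M) simp

lemma wpos_mmul: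
  assumes "wpos M" "wpos N"
  shows "wpos (mmul M N)"
proof -
  obtain a b c d a' b' c' d' where MN: "M = (a,b,c,d)" "N = (a',b',c',d')"
    by (cases M; cases N) auto
  have le: "1 \<le> x * y + z" if "1 \<le> x" "1 \<le> y" "0 \<le> z" for x y z :: real
    using mult_mono[of 1 x 1 y] that by simp
  have "mdet (mmul M N) = 1" using assms wpos_mdet by simp
  moreover have "1 \<le> a*a' + b*c'" "1 \<le> c*b' + d*d'"
    using assms le[of a a' "b*c'"] le[of d d' "c*b'"] MN by simp_all
  ultimately show ?thesis using assms MN by simp
qed

lemma wpos_mden: "wpos M \<Longrightarrow> x \<ge> 0 \<Longrightarrow> mden M x > 0"
  by (cases M) (auto intro: add_nonneg_pos)

lemma wpos_moeb_nonneg: "wpos M \<Longrightarrow> x \<ge> 0 \<Longrightarrow> moeb M x \<ge> 0"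
  by (cases M) simp

lemma wpos_moeb_pos:
  assumes "wpos M" "x > 0"
  shows "moeb M x > 0"
proof -
  obtain a b c d where M: "M = (a,b,c,d)" by (cases M) auto
  have "a * x > 0" using assms M by simp
  then have "a * x + b > 0" using assms M by (intro add_pos_nonneg) auto
  moreover have "c * x + d > 0" using wpos_mden[of M x] assms M by simp
  ultimately show ?thesis by (simp add: M)
qed

lemma wpos_moeb_mmul: "wpos N \<Longrightarrow> x \<ge> 0 \<Longrightarrow> moeb (mmul M N) x = moeb M (moeb N x)"
  using wpos_mden[of N x] by (intro moeb_mmul) simp

lemma wpos_moeb_diff:
  assumes "wpos (a,b,c,d)" "x \<ge> 0" "y \<ge> 0"
  shows "moeb (a,b,c,d) x - moeb (a,b,c,d) y = (x - y) / ((c*x+d) * (c*y+d))"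
proof -
  have den: "c*x+d \<noteq> 0" "c*y+d \<noteq> 0"
    using wpos_mden[OF assms(1), of x] wpos_mden[OF assms(1), of y] assms by auto
  then have "moeb (a,b,c,d) x - moeb (a,b,c,d) y
      = ((a*x+b) * (c*y+d) - (a*y+b) * (c*x+d)) / ((c*x+d) * (c*y+d))"
    by (simp add: diff_frac_eq)
  also have "(a*x+b) * (c*y+d) - (a*y+b) * (c*x+d) = (a*d - b*c) * (x - y)"
    by (simp add: algebra_simps)
  finally show ?thesis using assms(1) by simp
qed

lemma wpos_moeb_inj:
  assumes "wpos M" "x \<ge> 0" "y \<ge> 0" "moeb M x = moeb M y"
  shows "x = y"
proof -
  obtain a b c d where M: "M = (a,b,c,d)" by (cases M) auto
  have "c*x+d > 0" "c*y+d > 0"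
    using wpos_mden[of M x] wpos_mden[of M y] assms M by auto
  with wpos_moeb_diff[of a b c d x y] assms M show ?thesis by simp
qed

lemma wpos_fixes_pt: "wpos M \<Longrightarrow> x \<ge> 0 \<Longrightarrow> fixes_pt M x \<longleftrightarrow> moeb M x = x"
  using wpos_mden[of M x] by (auto simp: fixes_pt_iff)

section \<open>Sine quotients and the letters\<close>

locale hecke =
  fixes p :: nat
  assumes p3: "p \<ge> 3"
begin

text \<open>At a positive integer \<open>k\<close> this is the Chebyshev polynomial of the second
  kind of degree \<open>k - 1\<close> at \<open>cos (pi / p)\<close>. The real argument avoids
  truncated subtraction.\<close>

definition sn :: "real \<Rightarrow> real" where
  "sn x = sin (x * (pi / p)) / sin (pi / p)"

lemma sin_angle_pos: "sin (pi / p) > 0"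
  using p3 by (intro sin_gt_zero) (auto simp: field_simps)

lemma sn_0 [simp]: "sn 0 = 0" and sn_1 [simp]: "sn 1 = 1"
  using sin_angle_pos by (simp_all add: sn_def)

lemma sn_p [simp]: "sn (real p) = 0"
  using p3 by (simp add: sn_def)

lemma sn_diff_p: "sn (real p - x) = sn x"
proof -
  have "(real p - x) * (pi / p) = pi - x * (pi / p)"
    using p3 by (simp add: field_simps)
  then show ?thesis by (simp add: sn_def)
qed

lemma sn_rec: "sn (x + 1) = lam p * sn x - sn (x - 1)"
proof -
  define t where "t = pi / p"
  have "sin ((x + 1) * t) + sin ((x - 1) * t) = 2 * cos t * sin (x * t)"
    by (simp only: distrib_right left_diff_distrib mult_1 sin_add sin_diff) simp
  then have "sin ((x + 1) * t) / sin t + sin ((x - 1) * t) / sin t = 2 * cos t * (sin (x * t) / sin t)"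
    by (simp flip: add_divide_distrib)
  then show ?thesis by (simp add: sn_def lam_def t_def)
qed

text \<open>Gives the determinant of the letters, and collapses the coefficients that appear when
  two letters are compared.\<close>

lemma sn_cross: "sn (x + 1) * sn y - sn x * sn (y + 1) = sn (y - x)"
proof -
  define t where "t = pi / p"
  have t: "sin t > 0" using sin_angle_pos by (simp add: t_def)
  have "sin ((x+1) * t) * sin (y * t) - sin (x * t) * sin ((y+1) * t) = sin ((y - x) * t) * sin t"
    by (simp only: distrib_right left_diff_distrib mult_1 sin_add sin_diff) (simp add: algebra_simps)
  then have "(sin ((x+1) * t) * sin (y * t) - sin (x * t) * sin ((y+1) * t)) / (sin t * sin t)
      = sin ((y - x) * t) / sin t"
    using t by simp
  then show ?thesis by (simp add: sn_def diff_divide_distrib flip: t_def)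
qed

lemma sn_nonneg: "0 \<le> x \<Longrightarrow> x \<le> real p \<Longrightarrow> 0 \<le> sn x"
  using sin_angle_pos p3 unfolding sn_def
  by (intro divide_nonneg_pos sin_ge_zero) (auto simp: field_simps)

lemma sn_det: "sn x * sn x - sn (x + 1) * sn (x - 1) = 1"
  using sn_cross[of "x - 1" x] by (simp add: mult.commute)

text \<open>By \<open>sn_det\<close> the square of \<open>sn x\<close> is 1 plus a product that is
  nonnegative on this range.\<close>

lemma sn_ge_1:
  fixes x :: real
  assumes "1 \<le> x" "x + 1 \<le> p"
  shows "1 \<le> sn x"
proof (rule ccontr)
  assume "\<not> 1 \<le> sn x"
  then have "sn x * sn x < 1 * 1"
    using sn_nonneg[of x] assms by (intro mult_strict_mono') auto
  moreover have "0 \<le> sn (x + 1) * sn (x - 1)"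
    using assms by (intro mult_nonneg_nonneg sn_nonneg) auto
  ultimately show False using sn_det[of x] by simp
qed

lemma lam_ge_1: "1 \<le> lam p"
  using sn_rec[of 1] sn_ge_1[of 2] p3 by simp

definition W :: "nat \<Rightarrow> mat2" where
  "W k = (sn (real k), sn (real k + 1), sn (real k - 1), sn (real k))"

definition letters :: "nat set" where
  "letters = {1..p-1}"

primrec word :: "nat list \<Rightarrow> mat2" where
  "word [] = mid"
| "word (k # ks) = mmul (W k) (word ks)"

lemma word_append: "word (u @ v) = mmul (word u) (word v)"
  by (induction u) (simp_all add: mmul_assoc)

lemma word_concat: "word (concat (replicate n w)) = natpow (word w) n"
  by (induction n) (simp_all add: word_append)

lemma W_1: "W (Suc 0) = matS p"
  using sn_rec[of 1] by (simp add: W_def matS_def)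

lemma W_p: "W p = matT"
  using sn_rec[of "real p"] sn_diff_p[of 1] by (simp add: W_def matT_def)

text \<open>Hence \<open>W k\<close> is \<open>(S T)^(k-1) S\<close> for positive \<open>k\<close>;
  together with \<open>W_p\<close> this encodes the relation \<open>(S T)^p = -I\<close>.\<close>

lemma W_Suc: "mmul (matS p) (mmul matT (W k)) = W (Suc k)"
  using sn_rec[of k] sn_rec[of "real k + 1"]
  by (simp add: W_def matS_def matT_def add.commute[of 1 "real k"])

lemma wpos_W: "k \<in> letters \<Longrightarrow> wpos (W k)"
  using sn_det[of k] p3 by (auto simp: W_def letters_def intro!: sn_ge_1 sn_nonneg)

lemma wpos_word: "set w \<subseteq> letters \<Longrightarrow> wpos (word w)"
  by (induction w) (simp_all add: wpos_mid wpos_W wpos_mmul)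

lemma W_in_Gp: "W (Suc k) \<in> Gp p"
proof (induction k)
  case 0
  then show ?case using Gp_S[OF Gp_id[of p]] by (simp add: W_1)
next
  case (Suc k)
  then show ?case using Gp_S[OF Gp_T[OF Suc]] by (simp add: W_Suc)
qed

lemma word_in_Gp: "set w \<subseteq> letters \<Longrightarrow> word w \<in> Gp p"
proof (induction w)
  case (Cons k w)
  then have "W k \<in> Gp p" using W_in_Gp[of "k - 1"] by (auto simp: letters_def)
  with Cons show ?case by (simp add: Gp_mmul)
qed (simp add: Gp_id)

section \<open>Normal forms up to the cyclic group generated by \<open>matT\<close>\<close>

definition Trot :: "mat2 set" where
  "Trot = {mid, mneg mid, matT, mneg matT}"

lemma Trot_mneg: "e \<in> Trot \<Longrightarrow> mneg e \<in> Trot"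
  by (auto simp: Trot_def)

lemma Trot_matT: "e \<in> Trot \<Longrightarrow> mmul matT e \<in> Trot"
  by (auto simp: Trot_def mid_def matT_def)

lemma matTinv_eq: "matTinv = mneg matT"
  by (simp add: matTinv_def matT_def)

definition Tword :: "mat2 set" where
  "Tword = {mmul e (word u) | e u. e \<in> Trot \<and> set u \<subseteq> letters}"

lemma TwordI: "e \<in> Trot \<Longrightarrow> set u \<subseteq> letters \<Longrightarrow> mmul e (word u) \<in> Tword"
  unfolding Tword_def by blast

lemma TwordE:
  assumes "M \<in> Tword"
  obtains e u where "M = mmul e (word u)" "e \<in> Trot" "set u \<subseteq> letters"
  using assms unfolding Tword_def by blast

lemma Tword_mneg: "M \<in> Tword \<Longrightarrow> mneg M \<in> Tword"
  by (erule TwordE) (metis TwordI Trot_mneg mmul_mneg(1))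

lemma Tword_matT: "M \<in> Tword \<Longrightarrow> mmul matT M \<in> Tword"
  by (erule TwordE) (metis TwordI Trot_matT mmul_assoc)

lemma Tword_word: "set u \<subseteq> letters \<Longrightarrow> word u \<in> Tword"
  using TwordI[of mid u] by (simp add: Trot_def)

lemma matSinv_W_Suc:
  assumes "k \<noteq> 0"
  shows "mmul (matSinv p) (W (Suc k)) = mmul matT (W k)"
proof -
  have "mmul (matSinv p) (mmul (matS p) M) = M" for M
    by (cases M) (simp add: matS_def matSinv_def)
  then show ?thesis by (simp flip: W_Suc)
qed

lemma matSinv_matT: "mmul (matSinv p) matT = mmul matT (W (p - 1))"
  using matSinv_W_Suc[of "p - 1"] p3 by (simp add: W_p)

text \<open>Left multiplication by a generator only touches the first letter of a word; the
  word has to be nonempty because \<open>S T\<close> alone is not a rotated word.\<close>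

lemma Tword_generator:
  assumes u: "set (k # u) \<subseteq> letters" and e: "e \<in> Trot" and g: "g \<in> {matS p, matSinv p, matT, matTinv}"
  shows "mmul g (mmul e (word (k # u))) \<in> Tword"
proof -
  let ?w = "word (k # u)"
  have k: "1 \<le> k" "k \<le> p - 1" and u': "set u \<subseteq> letters" using u by (auto simp: letters_def)
  have S: "mmul (matS p) ?w \<in> Tword"
    using Tword_word[of "1 # k # u"] u p3 by (simp add: W_1 letters_def)
  \<comment> \<open>\<open>S T\<close> raises the first letter by one. Past the last letter it
    becomes \<open>W p\<close>, which is \<open>matT\<close>, and the word gets shorter.\<close>
  have ST: "mmul (matS p) (mmul matT ?w) \<in> Tword"
  proof -
    have eq: "mmul (matS p) (mmul matT ?w) = mmul (W (Suc k)) (word u)"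
      by (simp flip: W_Suc add: mmul_assoc)
    show ?thesis
    proof (cases "k = p - 1")
      case True
      then have "W (Suc k) = matT" using W_p p3 by simp
      then show ?thesis using Tword_matT[OF Tword_word[OF u']] unfolding eq by simp
    next
      case False
      then have "set (Suc k # u) \<subseteq> letters" using k u' by (auto simp: letters_def)
      from Tword_word[OF this] show ?thesis unfolding eq by simp
    qed
  qed
  have Si: "mmul (matSinv p) ?w \<in> Tword"
  proof (cases "k = 1")
    case True
    have "mmul (matSinv p) (mmul (matS p) M) = M" for M
      by (cases M) (simp add: matS_def matSinv_def)
    with True show ?thesis using Tword_word[OF u'] by (simp add: W_1)
  next
    case False
    then have l: "set ((k - 1) # u) \<subseteq> letters" using k u' by (auto simp: letters_def)
    have "mmul (matSinv p) ?w = mmul matT (word ((k - 1) # u))"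
      using matSinv_W_Suc[of "k - 1"] False k by (simp flip: mmul_assoc)
    then show ?thesis using Tword_matT[OF Tword_word[OF l]] by simp
  qed
  \<comment> \<open>Here the word grows: the inverse of \<open>S\<close> times \<open>T\<close>
    equals \<open>T\<close> times the last letter \<open>W (p - 1)\<close>.\<close>
  have SiT: "mmul (matSinv p) (mmul matT ?w) \<in> Tword"
  proof -
    have "mmul (matSinv p) (mmul matT ?w) = mmul matT (word ((p - 1) # k # u))"
      unfolding word.simps by (simp only: mmul_assoc[symmetric] matSinv_matT)
    moreover have "set ((p - 1) # k # u) \<subseteq> letters" using u p3 by (auto simp: letters_def)
    ultimately show ?thesis using Tword_matT[OF Tword_word[of "(p - 1) # k # u"]] by simp
  qed
  have T: "mmul matT ?w \<in> Tword" "mmul matT (mmul matT ?w) \<in> Tword"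
    using Tword_matT Tword_word[OF u] by blast+
  show ?thesis
    using e g S ST Si SiT T by (auto simp: Trot_def matTinv_eq intro: Tword_mneg simp del: word.simps)
qed

text \<open>Each generator costs one more copy of \<open>word w\<close> on the right, which keeps
  the word nonempty so that \<open>Tword_generator\<close> applies. When \<open>word w\<close> fixes
  the point under study, these factors do no harm.\<close>

lemma Gp_mult_word:
  assumes "N \<in> Gp p" "w \<noteq> []" "set w \<subseteq> letters"
  shows "\<exists>m. mmul N (natpow (word w) m) \<in> Tword"
  using assms(1)
proof (induction rule: Gp.induct)
  case Gp_id
  then show ?case using Tword_word[of "[]"] by (intro exI[of _ 0]) simp
next
  have step: "\<exists>m. mmul (mmul g M) (natpow (word w) m) \<in> Tword"
    if IH: "\<exists>m. mmul M (natpow (word w) m) \<in> Tword"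
      and g: "g \<in> {matS p, matSinv p, matT, matTinv}" for g M
  proof -
    obtain m e u where m: "mmul M (natpow (word w) m) = mmul e (word u)"
      and e: "e \<in> Trot" and u: "set u \<subseteq> letters"
      using IH unfolding Tword_def by blast
    obtain k ks where ks: "u @ w = k # ks" using assms(2) by (cases "u @ w") auto
    have "natpow (word w) (m + 1) = mmul (natpow (word w) m) (word w)"
      by (simp only: natpow_add) simp
    then have "mmul M (natpow (word w) (m + 1)) = mmul (mmul M (natpow (word w) m)) (word w)"
      by (simp only: mmul_assoc)
    also have "\<dots> = mmul e (word (k # ks))"
      by (simp only: m ks[symmetric] word_append mmul_assoc)
    finally have "mmul (mmul g M) (natpow (word w) (m + 1)) = mmul g (mmul e (word (k # ks)))"
      by (simp only: mmul_assoc)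
    moreover have "set (k # ks) \<subseteq> letters" using ks u assms(3) by (metis Un_least set_append)
    ultimately show ?thesis using Tword_generator[OF _ e g] by metis
  qed
  {
    case (Gp_S M) then show ?case using step by blast
  next
    case (Gp_Sinv M) then show ?case using step by blast
  next
    case (Gp_T M) then show ?case using step by blast
  next
    case (Gp_Tinv M) then show ?case using step by blast
  }
qed

text \<open>Without extra copies of a word, a power of \<open>matT\<close> must be allowed on the
  right: \<open>S T\<close> itself is \<open>W 1\<close> times \<open>matT\<close>.\<close>

lemma Gp_normal_form:
  assumes "N \<in> Gp p"
  shows "\<exists>M f. N = mmul M f \<and> M \<in> Tword \<and> f \<in> Trot"
  using assms
proof (induction rule: Gp.induct)
  case Gp_id
  have "mid \<in> Tword" using Tword_word[of "[]"] by simp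
  then show ?case by (intro exI[of _ mid]) (simp add: Trot_def)
next
  have step: "\<exists>M f. mmul g N = mmul M f \<and> M \<in> Tword \<and> f \<in> Trot"
    if IH: "\<exists>M f. N = mmul M f \<and> M \<in> Tword \<and> f \<in> Trot"
      and g: "g \<in> {matS p, matSinv p, matT, matTinv}" for g N
  proof -
    obtain e u f where N: "N = mmul (mmul e (word u)) f"
      and e: "e \<in> Trot" and f: "f \<in> Trot" and u: "set u \<subseteq> letters"
      using IH unfolding Tword_def by blast
    show ?thesis
    proof (cases u)
      case (Cons k ks)
      then have "mmul g (mmul e (word u)) \<in> Tword"
        using Tword_generator[OF _ e g, of k ks] u by simp
      then show ?thesis using f by (metis N mmul_assoc)
    next
      case Nil
      have 1: "word [1] = matS p" "set [1] \<subseteq> letters" and pp: "set [p - 1] \<subseteq> letters"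
        using p3 by (auto simp: W_1 letters_def)
      have Sinv: "matSinv p = mneg (mmul (mmul matT (word [p-1])) matT)"
        using arg_cong[OF matSinv_matT, of "\<lambda>M. mmul M matT"]
        by (simp add: mid_def matSinv_def matT_def W_def)
      have Te: "mmul matT (mmul e f) \<in> Trot" and ef: "mmul e f \<in> Trot"
        using e f by (auto simp: Trot_def matT_def mid_def)
      have gN: "N = mmul e f" using N Nil by simp
      have "mid \<in> Tword" using Tword_word[of "[]"] by simp
      then have T: "M \<in> Trot \<Longrightarrow> \<exists>K f. M = mmul K f \<and> K \<in> Tword \<and> f \<in> Trot" for M
        by (intro exI[of _ mid] exI[of _ M]) simp
      consider "g = matS p" | "g = matSinv p" | "g = matT" | "g = matTinv" using g by blast
      then show ?thesis
      proof cases
        case 1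
        then show ?thesis using gN ef Tword_word[of "[1]"] \<open>word [1] = matS p\<close> \<open>set [1] \<subseteq> letters\<close>
          by (intro exI[of _ "matS p"] exI[of _ "mmul e f"]) auto
      next
        case 2
        have "mmul g N = mmul (mneg (mmul matT (word [p-1]))) (mmul matT (mmul e f))"
          unfolding gN 2 Sinv by (simp add: mmul_assoc)
        moreover have "mneg (mmul matT (word [p-1])) \<in> Tword"
          by (intro Tword_mneg Tword_matT Tword_word pp)
        ultimately show ?thesis using Te by (intro exI conjI)
      next
        case 3
        show ?thesis using T[OF Te] unfolding gN 3 .
      next
        case 4
        show ?thesis using T[OF Trot_mneg[OF Te]] unfolding gN 4 matTinv_eq mmul_mneg .
      qed
    qed
  qed
  {
    case (Gp_S M) then show ?case using step by blast
  next
    case (Gp_Sinv M) then show ?case using step by blast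
  next
    case (Gp_T M) then show ?case using step by blast
  next
    case (Gp_Tinv M) then show ?case using step by blast
  }
qed

end

section \<open>Simple numbers as fixed points of words\<close>

lemma fixes_pt_natpow: "fixes_pt M x \<Longrightarrow> fixes_pt (natpow M n) x"
  by (induction n) (simp_all add: fixes_pt_mmul, simp add: mid_def)

lemma wpos_trace_gt_2:
  assumes "wpos (a,b,c,d)" "b > 0" "c > 0"
  shows "a + d > 2"
proof -
  have "b * c > 0" using assms by simp
  moreover have "a * d = 1 + b * c" using assms by simp
  ultimately have "a * d > 1" by simp
  moreover have "a \<noteq> 1 \<or> d \<noteq> 1" using \<open>a * d > 1\<close> by auto
  moreover have "a \<ge> 1" "d \<ge> 1" using assms by auto
  ultimately show ?thesis by auto
qed

context hecke
begin

section \<open>Uniqueness of words and primitive fixing words\<close>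

lemma sn_letter:
  assumes "k \<in> letters"
  shows "sn k \<ge> 1" "sn (real k - 1) \<ge> 0" "sn (real k + 1) \<ge> 0"
    and "k = 1 \<or> sn (real k - 1) \<ge> 1" "k = p - 1 \<or> sn (real k + 1) \<ge> 1"
proof -
  have k: "1 \<le> k" "k + 1 \<le> p" using assms p3 by (auto simp: letters_def)
  then have r: "1 \<le> real k" "real k + 1 \<le> real p" by linarith+
  show "sn k \<ge> 1" "sn (real k - 1) \<ge> 0" "sn (real k + 1) \<ge> 0"
    using r by (auto intro!: sn_ge_1 sn_nonneg)
  show "k = 1 \<or> sn (real k - 1) \<ge> 1"
  proof (cases "k = 1")
    case False
    then have "2 \<le> real k" using k by linarith
    then show ?thesis using r by (auto intro!: sn_ge_1)
  qed simp
  show "k = p - 1 \<or> sn (real k + 1) \<ge> 1"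
  proof (cases "k = p - 1")
    case False
    then have "k + 2 \<le> p" using k by linarith
    then have "real k + 2 \<le> real p" by linarith
    then show ?thesis using r by (auto intro!: sn_ge_1)
  qed simp
qed

lemma word_pos: "set w \<subseteq> letters \<Longrightarrow> x > 0 \<Longrightarrow> moeb (word w) x > 0"
  by (simp add: wpos_word wpos_moeb_pos)

lemma word_nonneg: "set w \<subseteq> letters \<Longrightarrow> x \<ge> 0 \<Longrightarrow> moeb (word w) x \<ge> 0"
  by (simp add: wpos_word wpos_moeb_nonneg)

lemma moeb_word_append:
  "set v \<subseteq> letters \<Longrightarrow> x \<ge> 0 \<Longrightarrow> moeb (word (u @ v)) x = moeb (word u) (moeb (word v) x)"
  by (simp add: word_append wpos_moeb_mmul wpos_word)

lemma moeb_word_Cons: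
  "set v \<subseteq> letters \<Longrightarrow> x \<ge> 0 \<Longrightarrow> moeb (word (k # v)) x = moeb (W k) (moeb (word v) x)"
  by (simp add: wpos_moeb_mmul wpos_word)

lemma moeb_mid [simp]: "moeb mid x = x"
  by (simp add: mid_def)

text \<open>After cross-multiplication, \<open>sn_cross\<close> turns the four coefficients into
  values of \<open>sn\<close> at \<open>j - k\<close> and its neighbours. All are nonnegative and
  the constant term is at least 1, so the sum cannot vanish.\<close>

lemma W_separated:
  assumes k: "k \<in> letters" and j: "j \<in> letters" and "k < j" "y > 0" "z > 0"
  shows "moeb (W k) y \<noteq> moeb (W j) z"
proof
  assume eq: "moeb (W k) y = moeb (W j) z"
  have r: "1 \<le> real k" "real k + 1 \<le> real j" "real j + 1 \<le> real p"
    using assms by (auto simp: letters_def)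
  have den: "sn (real k - 1) * y + sn k > 0" "sn (real j - 1) * z + sn j > 0"
    using wpos_mden[OF wpos_W[OF k], of y] wpos_mden[OF wpos_W[OF j], of z] assms
    by (simp_all add: W_def)
  have "(sn k * y + sn (real k + 1)) * (sn (real j - 1) * z + sn j)
      - (sn j * z + sn (real j + 1)) * (sn (real k - 1) * y + sn k) = 0"
    using eq den by (simp add: W_def frac_eq_eq)
  then have "y * z * (sn k * sn (real j - 1) - sn (real k - 1) * sn j)
      + y * (sn k * sn j - sn (real k - 1) * sn (real j + 1))
      + z * (sn (real k + 1) * sn (real j - 1) - sn k * sn j)
      + (sn (real k + 1) * sn j - sn k * sn (real j + 1)) = 0"
    by (simp add: algebra_simps)
  then have "y * z * sn (real j - real k) + y * sn (real j - real k + 1)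
      + z * sn (real j - real k - 1) + sn (real j - real k) = 0"
    using sn_cross[of "real k - 1" "real j - 1"] sn_cross[of "real k - 1" j]
      sn_cross[of k "real j - 1"] sn_cross[of k j]
    by (simp add: algebra_simps)
  moreover have "sn (real j - real k) \<ge> 1"
    using r by (intro sn_ge_1) auto
  moreover have "y * z * sn (real j - real k) \<ge> 0" "y * sn (real j - real k + 1) \<ge> 0"
    "z * sn (real j - real k - 1) \<ge> 0"
    using r assms by (auto intro!: mult_nonneg_nonneg sn_nonneg)
  ultimately show False by linarith
qed

lemma W_eqD:
  assumes "k \<in> letters" "j \<in> letters" "y > 0" "z > 0" "moeb (W k) y = moeb (W j) z"
  shows "k = j \<and> y = z"
proof -
  have "k = j"
    using W_separated[of k j y z] W_separated[of j k z y] assms by (metis linorder_neqE_nat)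
  moreover have "y = z"
    using wpos_moeb_inj[OF wpos_W[of k], of y z] assms \<open>k = j\<close> by simp
  ultimately show ?thesis ..
qed

text \<open>Since distinct letters have disjoint images, the letters can be read off from the value
  one at a time.\<close>

lemma word_prefix:
  assumes "set u \<subseteq> letters" "set v \<subseteq> letters" "x > 0" "y > 0"
    and "moeb (word u) x = moeb (word v) y" "length u \<le> length v"
  shows "\<exists>v'. v = u @ v' \<and> x = moeb (word v') y"
  using assms
proof (induction u arbitrary: v)
  case (Cons k u)
  then obtain j v1 where v: "v = j # v1" by (cases v) auto
  have l: "set u \<subseteq> letters" "set v1 \<subseteq> letters" "k \<in> letters" "j \<in> letters"
    using Cons.prems v by auto
  have "moeb (W k) (moeb (word u) x) = moeb (W j) (moeb (word v1) y)"
    using Cons.prems(3-5) l unfolding v by (simp only: moeb_word_Cons less_imp_le)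
  then have "k = j" "moeb (word u) x = moeb (word v1) y"
    using W_eqD[of k j "moeb (word u) x" "moeb (word v1) y"] word_pos Cons.prems l by auto
  with Cons.IH[of v1] Cons.prems l v show ?case by auto
qed simp

text \<open>The entry is a sum of two nonnegative terms, so both vanish; this forces every letter to
  be 1.\<close>

lemma word_lower_left_0:
  assumes "set w \<subseteq> letters" "word w = (a,b,0,d)"
  shows "word w = (1, length w * lam p, 0, 1)"
  using assms
proof (induction w arbitrary: a b d)
  case (Cons k w)
  obtain a' b' c' d' where w: "word w = (a',b',c',d')" by (cases "word w") auto
  have k: "k \<in> letters" and "wpos (word w)" using Cons.prems wpos_word by auto
  then have pos: "a' \<ge> 1" "c' \<ge> 0" using w by auto
  have 0: "sn (real k - 1) * a' + sn k * c' = 0" using Cons.prems w by (simp add: W_def)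
  have "0 \<le> sn (real k - 1) * a'" "0 \<le> sn k * c'" using sn_letter[OF k] pos by auto
  then have "sn (real k - 1) * a' = 0" "sn k * c' = 0" using 0 by linarith+
  then have "sn (real k - 1) = 0" "c' = 0" using sn_letter(1)[OF k] pos by auto
  then have "k = 1" "word w = (1, length w * lam p, 0, 1)"
    using sn_letter(4)[OF k] Cons.IH[of a' b' d'] Cons.prems w by auto
  then show ?case by (simp add: W_1 matS_def algebra_simps)
qed (simp add: mid_def)

lemma W_last: "W (p - 1) = (1, 0, lam p, 1)"
proof -
  have "sn (real p - 1 - 1) = lam p" using sn_diff_p[of 2] sn_rec[of 1] by simp
  then show ?thesis using p3 sn_diff_p[of 1] by (simp add: W_def of_nat_diff)
qed

lemma word_upper_right_0:
  assumes "set w \<subseteq> letters" "word w = (a,0,c,d)"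
  shows "word w = (1, 0, length w * lam p, 1)"
  using assms
proof (induction w arbitrary: a c d)
  case (Cons k w)
  obtain a' b' c' d' where w: "word w = (a',b',c',d')" by (cases "word w") auto
  have k: "k \<in> letters" and "wpos (word w)" using Cons.prems wpos_word by auto
  then have pos: "d' \<ge> 1" "b' \<ge> 0" using w by auto
  have 0: "sn k * b' + sn (real k + 1) * d' = 0" using Cons.prems w by (simp add: W_def)
  have "0 \<le> sn (real k + 1) * d'" "0 \<le> sn k * b'" using sn_letter[OF k] pos by auto
  then have "sn (real k + 1) * d' = 0" "sn k * b' = 0" using 0 by linarith+
  then have "sn (real k + 1) = 0" "b' = 0" using sn_letter(1)[OF k] pos by auto
  then have "k = p - 1" "word w = (1, 0, length w * lam p, 1)"
    using sn_letter(5)[OF k] Cons.IH[of a' c' d'] Cons.prems w by auto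
  then show ?case unfolding word.simps \<open>k = p - 1\<close> W_last by (simp add: algebra_simps)
qed (simp add: mid_def)

text \<open>A zero off the diagonal makes the word unipotent. If it is upper triangular, it is a
  nontrivial translation; if lower triangular, it fixes only 0. Neither fixes a positive
  point.\<close>

lemma word_fixing_entries:
  assumes w: "set w \<subseteq> letters" "w \<noteq> []" and "x > 0" and fixed: "moeb (word w) x = x"
    and M: "word w = (a,b,c,d)"
  shows "b > 0" "c > 0"
proof -
  have pos: "b \<ge> 0" "c \<ge> 0" using wpos_word[OF w(1)] M by auto
  have len: "length w * lam p > 0" using w lam_ge_1 by simp
  have "c \<noteq> 0"
  proof
    assume "c = 0"
    with word_lower_left_0[OF w(1)] M have "word w = (1, length w * lam p, 0, 1)" by simp
    with fixed len show False by (auto simp del: zero_less_mult_iff)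
  qed
  moreover have "b \<noteq> 0"
  proof
    assume "b = 0"
    with word_upper_right_0[OF w(1)] M have e: "word w = (1, 0, length w * lam p, 1)" by simp
    have "length w * lam p * x > 0" using mult_pos_pos[OF len \<open>x > 0\<close>] by simp
    moreover have "x / (length w * lam p * x + 1) = x" using fixed e by simp
    ultimately have "length w * lam p * x = 0" using \<open>x > 0\<close> by (simp add: divide_eq_eq)
    with \<open>length w * lam p * x > 0\<close> show False by linarith
  qed
  ultimately show "b > 0" "c > 0" using pos by auto
qed

text \<open>A shortest nonempty fixing word is a prefix of every other one, and the remainder fixes
  \<open>x\<close> again; induction on the length strips off copies of it.\<close>

lemma primitive_fixing_word:
  assumes "set w \<subseteq> letters" "w \<noteq> []" "x > 0" "moeb (word w) x = x"
  obtains v where "set v \<subseteq> letters" "v \<noteq> []" "moeb (word v) x = x"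
    "\<And>u. set u \<subseteq> letters \<Longrightarrow> moeb (word u) x = x \<Longrightarrow> \<exists>n. word u = natpow (word v) n"
proof -
  let ?P = "\<lambda>u. set u \<subseteq> letters \<and> u \<noteq> [] \<and> moeb (word u) x = x"
  obtain v where v: "?P v" and min: "\<And>u. ?P u \<Longrightarrow> length v \<le> length u"
    using ex_has_least_nat[of ?P w length] assms by blast
  have "\<exists>n. word u = natpow (word v) n"
    if "set u \<subseteq> letters" "moeb (word u) x = x" for u
    using that
  proof (induction "length u" arbitrary: u rule: less_induct)
    case less
    show ?case
    proof (cases "u = []")
      case True
      then show ?thesis by (intro exI[of _ 0]) simp
    next
      case False
      then have "length v \<le> length u" using min less.prems by simp
      then obtain u' where u': "u = v @ u'" "x = moeb (word u') x"
        using word_prefix[of v u x x] v less.prems \<open>x > 0\<close> by auto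
      then obtain n where "word u' = natpow (word v) n"
        using less.hyps[of u'] less.prems v by auto
      then have "word u = natpow (word v) (Suc n)" by (simp add: u' word_append)
      then show ?thesis ..
    qed
  qed
  with v that show thesis by blast
qed

lemma word_fixes_pt: "set w \<subseteq> letters \<Longrightarrow> x \<ge> 0 \<Longrightarrow> fixes_pt (word w) x \<longleftrightarrow> moeb (word w) x = x"
  by (simp add: wpos_fixes_pt wpos_word)

section \<open>Stabilizers and Hecke conjugates\<close>

lemma stab_generator_primitive:
  assumes v: "set v \<subseteq> letters" "v \<noteq> []" "moeb (word v) x = x" and x: "x > 0"
    and prim: "\<And>u. set u \<subseteq> letters \<Longrightarrow> moeb (word u) x = x \<Longrightarrow> \<exists>n. word u = natpow (word v) n"
  shows "stab_generator p x (word v)"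
proof -
  have fv: "fixes_pt (word v) x" using v x by (simp add: word_fixes_pt)
  have det: "mdet (word v) = 1" using wpos_mdet[OF wpos_word[OF v(1)]] .
  have "\<exists>k. N = mpow (word v) k \<or> N = mneg (mpow (word v) k)"
    if N: "N \<in> Gp p" "fixes_pt N x" for N
  proof -
    obtain m e u where m: "mmul N (natpow (word v) m) = mmul e (word u)"
      and e: "e \<in> Trot" and u: "set u \<subseteq> letters"
      using Gp_mult_word[OF N(1) v(2,1)] by (auto elim: TwordE)
    have "fixes_pt (mmul e (word u)) x"
      unfolding m[symmetric] by (intro fixes_pt_mmul N fixes_pt_natpow fv)
    then have eu: "moeb e (moeb (word u) x) = x"
      using wpos_moeb_mmul[OF wpos_word[OF u], of x e] x by (simp add: fixes_pt_iff)
    have "moeb (word u) x > 0" using u x by (rule word_pos)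
    \<comment> \<open>A rotation \<open>matT\<close>, up to sign, would make the positive
      \<open>x\<close> a negative reciprocal of a positive number. So \<open>e\<close> is trivial up
      to sign and the word itself fixes \<open>x\<close>.\<close>
    then have "- (1 / moeb (word u) x) < 0" by simp
    then have "- (1 / moeb (word u) x) < x" using x by (rule less_trans)
    moreover have "moeb matT t = - (1 / t)" "moeb (mneg matT) t = - (1 / t)" for t
      by (simp_all add: matT_def)
    ultimately have "e \<noteq> matT" "e \<noteq> mneg matT" using eu by (metis less_irrefl)+
    then have e': "e = mid \<or> e = mneg mid" using e by (auto simp: Trot_def)
    then have "moeb (word u) x = x" using eu by (auto simp: mid_def)
    then obtain i where i: "word u = natpow (word v) i" using prim u by blast
    from e' show ?thesis
    proof
      assume "e = mid"
      then have "mmul N (natpow (word v) m) = natpow (word v) i" using m i by simp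
      from mpow_eqI[OF det this] show ?thesis by blast
    next
      assume "e = mneg mid"
      then have "mmul (mneg N) (natpow (word v) m) = natpow (word v) i" using m i by simp
      from mpow_eqI[OF det this] show ?thesis by (metis mneg_mneg)
    qed
  qed
  then show ?thesis using fv word_in_Gp[OF v(1)] by (simp add: stab_generator_def)
qed

text \<open>The product of the two fixed points is \<open>- b / c\<close>, hence negative.\<close>

lemma fixing_word_conj:
  assumes w: "set w \<subseteq> letters" "w \<noteq> []" and x: "x > 0" and fixed: "moeb (word w) x = x"
    and M: "word w = (a,b,c,d)"
  shows "(a - d) / c - x < 0" "fixes_pt (word w) ((a - d) / c - x)" "mtrace (word w) > 2"
proof -
  have bc: "b > 0" "c > 0" using word_fixing_entries[OF w x fixed M] by auto
  have fp: "fixes_pt (a,b,c,d) x" using fixed word_fixes_pt[OF w(1), of x] x M by simp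
  have "x * (a - d - c * x) = - b" using fixes_pt_quadratic[OF fp] by (simp add: algebra_simps)
  then have "x * (a - d - c * x) < 0" using bc by simp
  then have "a - d - c * x < 0" using x by (simp add: mult_less_0_iff)
  then show "(a - d) / c - x < 0" using bc by (simp add: field_simps)
  have wp: "wpos (a,b,c,d)" using wpos_word[OF w(1)] M by simp
  then show "fixes_pt (word w) ((a - d) / c - x)"
    using fixes_pt_conj[OF fp] bc M by simp
  show "mtrace (word w) > 2" using wpos_trace_gt_2[OF wp] bc M by simp
qed

text \<open>The description ranges over all hyperbolic elements fixing \<open>x\<close>, so
  uniqueness is the point: each is, up to sign, a nonzero power of one primitive word, and all these
  powers share the second fixed point.\<close>

lemma hecke_conj_word:
  assumes w: "set w \<subseteq> letters" "w \<noteq> []" and x: "x > 0" and fixed: "moeb (word w) x = x"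
    and M: "word w = (a,b,c,d)"
  shows "hecke_conj p x = (a - d) / c - x"
  unfolding hecke_conj_def
proof (rule the_equality)
  let ?y = "(a - d) / c - x"
  note c = fixing_word_conj[OF w x fixed M]
  have fw: "fixes_pt (word w) x" using fixed w x by (simp add: word_fixes_pt)
  show "?y \<noteq> x \<and> (\<exists>M\<in>Gp p. 2 < \<bar>mtrace M\<bar> \<and> fixes_pt M x \<and> fixes_pt M ?y)"
    using c x fw word_in_Gp[OF w(1)] by (intro conjI bexI[of _ "word w"]) auto
  fix z
  assume "z \<noteq> x \<and> (\<exists>M\<in>Gp p. 2 < \<bar>mtrace M\<bar> \<and> fixes_pt M x \<and> fixes_pt M z)"
  then obtain N where z: "z \<noteq> x" and N: "N \<in> Gp p" "2 < \<bar>mtrace N\<bar>" "fixes_pt N x" "fixes_pt N z"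
    by blast
  obtain v where v: "set v \<subseteq> letters" "v \<noteq> []" "moeb (word v) x = x"
    and prim: "\<And>u. set u \<subseteq> letters \<Longrightarrow> moeb (word u) x = x \<Longrightarrow> \<exists>n. word u = natpow (word v) n"
    using primitive_fixing_word[OF w x fixed] by blast
  have det: "mdet (word v) = 1" using wpos_mdet[OF wpos_word[OF v(1)]] .
  obtain av bv cv dv where Mv: "word v = (av,bv,cv,dv)" by (cases "word v") auto
  define y where "y = (av - dv) / cv - x"
  note cv = fixing_word_conj[OF v(1,2) x v(3) Mv, folded y_def]
  have unique: "t = y" if u: "set u \<subseteq> letters" "u \<noteq> []" and ux: "moeb (word u) x = x"
    and t: "fixes_pt (word u) t" "t \<noteq> x" for u t
  proof -
    obtain a b c d where Mu: "word u = (a,b,c,d)" by (cases "word u") auto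
    have "c \<noteq> 0" using word_fixing_entries[OF u x ux Mu] by simp
    have fx: "fixes_pt (word u) x" using ux u x by (simp add: word_fixes_pt)
    obtain n where "word u = natpow (word v) n" using prim u ux by blast
    then have "fixes_pt (word u) y" using fixes_pt_natpow[OF cv(2)] by simp
    then show ?thesis
      using fixes_pt_two[of a b c d x y] fixes_pt_two[of a b c d x t] fx t cv(1) x \<open>c \<noteq> 0\<close> Mu by simp
  qed
  obtain k where k: "N = mpow (word v) k \<or> N = mneg (mpow (word v) k)"
    using stab_generator_primitive[OF v x prim] N unfolding stab_generator_def by blast
  have Kz: "fixes_pt (mpow (word v) k) z" using k N by auto
  have "k \<noteq> 0" using k N(2) by (auto simp: mpow_def mid_def)
  have "fixes_pt (natpow (word v) (nat \<bar>k\<bar>)) z"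
  proof (cases "k \<ge> 0")
    case True
    then show ?thesis using Kz by (simp add: mpow_def natpow_def)
  next
    case False
    then have "fixes_pt (natpow (minv (word v)) (nat \<bar>k\<bar>)) z" using Kz by (simp add: mpow_def natpow_def)
    \<comment> \<open>For negative \<open>k\<close> only the inverse power is known to fix
      \<open>z\<close>. The product with the positive power is the identity, so the inverse power
      can be cancelled.\<close>
    moreover have "fixes_pt (mmul (natpow (word v) (nat \<bar>k\<bar>)) (natpow (minv (word v)) (nat \<bar>k\<bar>))) z"
      unfolding natpow_minv[OF det] by (simp add: mid_def)
    ultimately show ?thesis by (rule fixes_pt_cancel_right[rotated])
  qed
  then have "fixes_pt (word (concat (replicate (nat \<bar>k\<bar>) v))) z" by (simp add: word_concat)
  moreover have "moeb (word (concat (replicate (nat \<bar>k\<bar>) v))) x = x"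
    using fixes_pt_natpow[of "word v" x "nat \<bar>k\<bar>"] v x word_fixes_pt[OF v(1), of x]
    by (simp add: word_concat fixes_pt_iff[of "natpow _ _"])
  ultimately have "z = y"
    using v z \<open>k \<noteq> 0\<close> by (intro unique[of "concat (replicate (nat \<bar>k\<bar>) v)"]) auto
  moreover have "?y = y" using c x w fixed by (intro unique[of w]) auto
  ultimately show "z = ?y" by simp
qed

text \<open>The primitive word generates the stabilizer, and its positive off-diagonal entries are
  exactly the sign conditions on the form.\<close>

lemma simple_number_if_word:
  assumes w: "set w \<subseteq> letters" "w \<noteq> []" and x: "x > 0" and fixed: "moeb (word w) x = x"
  shows "Gp_simple_number p x"
proof -
  obtain v where v: "set v \<subseteq> letters" "v \<noteq> []" "moeb (word v) x = x"
    and prim: "\<And>u. set u \<subseteq> letters \<Longrightarrow> moeb (word u) x = x \<Longrightarrow> \<exists>n. word u = natpow (word v) n"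
    using primitive_fixing_word[OF w x fixed] by blast
  obtain a b c d where M: "word v = (a,b,c,d)" by (cases "word v") auto
  have bc: "b > 0" "c > 0" using word_fixing_entries[OF v(1,2) x v(3) M] by auto
  have gen: "stab_generator p x (a,b,c,d)"
    using stab_generator_primitive[OF v x prim] M by simp
  have det: "a*d - b*c = 1" using wpos_word[OF v(1)] M by simp
  have fp: "fixes_pt (a,b,c,d) x" using gen by (simp only: stab_generator_def)
  have hyp: "hyp_fixed_point p x"
    using fixing_word_conj(3)[OF v(1,2) x v(3) M] word_in_Gp[OF v(1)] fp M
    unfolding hyp_fixed_point_def by (intro bexI[of _ "word v"]) auto
  have q: "c*x*x + d*x - a*x = b" using fixes_pt_quadratic[OF fp] by simp
  have D: "(a+d)^2 - 4 = (d-a)^2 + 4*c*b" using det by (simp add: power2_eq_square algebra_simps)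
  have sq: "(d-a)^2 + 4*c*b = (2*c*x + d - a)^2"
    unfolding q[symmetric] by (simp add: power2_eq_square algebra_simps)
  \<comment> \<open>\<open>c*x + d - a\<close> equals \<open>b / x\<close>; its positivity selects
    the plus sign in front of the square root.\<close>
  have "x * (c*x + d - a) = b" using q by (simp add: algebra_simps)
  then have "x * (c*x + d - a) > 0" using bc by simp
  then have "c*x + d - a > 0" using x by (simp add: zero_less_mult_iff)
  moreover have "c * x > 0" using bc x by simp
  ultimately have "sqrt ((d-a)^2 + 4*c*b) = 2*c*x + d - a" unfolding sq by simp
  then have al: "x = (a - d + sqrt ((d-a)^2 + 4*c*b)) / (2*c)" using bc by simp
  have "hyperbolic_form p (c, d - a, - b)"
    unfolding hyperbolic_form_def using hyp gen al D
    by (intro exI[of _ x] exI[of _ a] exI[of _ b] exI[of _ c] exI[of _ d]) simp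
  moreover have "a \<in> Zlam p" "b \<in> Zlam p" "c \<in> Zlam p" "d \<in> Zlam p"
    using Gp_Zlam[OF word_in_Gp[OF v(1)]] M by auto
  then have "lambda_bqf p (c, d - a, - b)"
    using bc by (auto intro: Zlam_diff Zlam_uminus add_nonneg_pos)
  ultimately have "Gp_simple_form p (c, d - a, - b)" using bc by simp
  moreover have "x = alpha_Q (c, d - a, - b)" using al by simp
  ultimately show ?thesis unfolding Gp_simple_number_def by blast
qed

section \<open>Transposed words and the reduction of simple numbers to words\<close>

lemma mtransp_W:
  assumes "k \<in> letters"
  shows "mtransp (W k) = W (p - k)"
proof -
  have k: "real (p - k) = real p - real k" using assms by (auto simp: letters_def)
  have "sn (real p - real k + 1) = sn (real k - 1)" "sn (real p - real k - 1) = sn (real k + 1)"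
    using sn_diff_p[of "real k - 1"] sn_diff_p[of "real k + 1"] by (simp_all add: algebra_simps)
  then show ?thesis by (simp add: W_def k sn_diff_p)
qed

text \<open>Transposition reverses the word and replaces each letter \<open>k\<close> by
  \<open>p - k\<close>.\<close>

lemma mtransp_word:
  "set u \<subseteq> letters \<Longrightarrow> \<exists>v. set v \<subseteq> letters \<and> mtransp (word u) = word v"
proof (induction u)
  case Nil
  then show ?case by (intro exI[of _ "[]"]) (simp add: mid_def)
next
  case (Cons k u)
  then obtain v where v: "set v \<subseteq> letters" "mtransp (word u) = word v" by auto
  have k: "k \<in> letters" using Cons.prems by simp
  then have "p - k \<in> letters" by (auto simp: letters_def)
  moreover have "mtransp (word (k # u)) = word (v @ [p - k])"
    using v mtransp_W[OF k] by (simp add: mtransp_mmul word_append)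
  ultimately show ?case using v by (intro exI[of _ "v @ [p - k]"]) simp
qed

text \<open>In the normal form \<open>e w f\<close> with \<open>e\<close>, \<open>f\<close> powers of \<open>T\<close>, the condition
  \<open>bc > 0\<close> leaves only \<open>\<plusminus>w\<close> and \<open>\<plusminus>T w T\<close>; the latter is the inverse of
  the transpose of \<open>w\<close> up to sign.\<close>

lemma word_if_simple_number:
  assumes "Gp_simple_number p x"
  shows "x > 0 \<and> (\<exists>w. set w \<subseteq> letters \<and> w \<noteq> [] \<and> moeb (word w) x = x)"
proof -
  obtain Q where Q: "Gp_simple_form p Q" "x = alpha_Q Q" using assms by (auto simp: Gp_simple_number_def)
  have "hyperbolic_form p Q" using Q(1) by (cases Q) simp
  then obtain y a b c d where gen: "stab_generator p y (a,b,c,d)"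
    and y: "y = (a - d + sqrt ((a+d)^2 - 4)) / (2*c)" and Qe: "Q = (c, d - a, - b)"
    unfolding hyperbolic_form_def by blast
  have bc: "b > 0" "c > 0" using Q(1) Qe by auto
  have MG: "(a,b,c,d) \<in> Gp p" and fy: "fixes_pt (a,b,c,d) y"
    using gen unfolding stab_generator_def by blast+
  have det: "a*d - b*c = 1" using mdet_Gp[OF MG] by simp
  have D: "(a+d)^2 - 4 = (d-a)^2 + 4*c*b" using det by (simp add: power2_eq_square algebra_simps)
  have xy: "x = y" using Q(2) unfolding Qe y D by simp
  have "\<bar>d - a\<bar> < sqrt ((d-a)^2 + 4*c*b)"
    using bc by (intro real_less_rsqrt) simp
  then have "a - d + sqrt ((d-a)^2 + 4*c*b) > 0" by linarith
  then have x: "x > 0" unfolding xy y D using bc by simp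
  have M0: "b * c > 0" using bc by simp
  obtain K f where Kf: "(a,b,c,d) = mmul K f" "K \<in> Tword" and f: "f \<in> Trot"
    using Gp_normal_form[OF MG] by blast
  then obtain e u where M: "(a,b,c,d) = mmul (mmul e (word u)) f"
    and e: "e \<in> Trot" and u: "set u \<subseteq> letters" by (auto elim!: TwordE)
  obtain a' b' c' d' where Mu: "word u = (a',b',c',d')" by (cases "word u") auto
  have wp: "wpos (a',b',c',d')" using wpos_word[OF u] Mu by simp
  have "a' * d' > 0" using wp by simp
  \<comment> \<open>If exactly one of \<open>e\<close> and \<open>f\<close> is \<open>matT\<close>
    up to sign, the off-diagonal product is \<open>- (a' * d')\<close>; this inequality rules those
    cases out.\<close>
  then have n: "b * c \<noteq> - (a' * d')" using M0 by linarith
  have cases: "(a,b,c,d) \<in> {(a',b',c',d'), mneg (a',b',c',d')}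
      \<or> (a,b,c,d) \<in> {(d',-c',-b',a'), mneg (d',-c',-b',a')}"
    using M e f n unfolding Mu Trot_def by (auto simp: matT_def mid_def)
  have "\<exists>w. set w \<subseteq> letters \<and> fixes_pt (word w) x \<and> word w \<noteq> mid"
    using cases
  proof
    assume "(a,b,c,d) \<in> {(a',b',c',d'), mneg (a',b',c',d')}"
    then have "(a,b,c,d) = word u \<or> (a,b,c,d) = mneg (word u)" using Mu by auto
    then have "fixes_pt (word u) x" using fy xy by (metis fixes_pt_mneg)
    moreover have "word u \<noteq> mid" using \<open>_ \<or> (a,b,c,d) = mneg (word u)\<close> bc by (auto simp: mid_def)
    ultimately show ?thesis using u by blast
  next
    assume A: "(a,b,c,d) \<in> {(d',-c',-b',a'), mneg (d',-c',-b',a')}"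
    obtain v where v: "set v \<subseteq> letters" "mtransp (word u) = word v" using mtransp_word[OF u] by blast
    have "minv (a,b,c,d) = word v \<or> minv (a,b,c,d) = mneg (word v)"
      using A by (auto simp: v(2)[symmetric] Mu)
    moreover have "fixes_pt (minv (a,b,c,d)) x" using fy xy det by (intro fixes_pt_minv) auto
    ultimately have "fixes_pt (word v) x" by (metis fixes_pt_mneg)
    moreover have "word v \<noteq> mid" using A bc by (auto simp: v(2)[symmetric] Mu mid_def)
    ultimately show ?thesis using v by blast
  qed
  then obtain w where "set w \<subseteq> letters" "fixes_pt (word w) x" "word w \<noteq> mid" by blast
  then have "set w \<subseteq> letters \<and> w \<noteq> [] \<and> moeb (word w) x = x" by (auto simp: fixes_pt_iff)
  with x show ?thesis by blast
qed

end

section \<open>Continued fractions\<close>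

lemma cf_x_add: "cf_x p x (j + k) = cf_x p (cf_x p x j) k"
  by (induction k) simp_all

lemma cf_r_add: "cf_r p x (j + k) = cf_r p (cf_x p x j) k"
  by (simp add: cf_r_def cf_x_add)

context hecke
begin

section \<open>Blocks of the continued fraction\<close>

lemma W_pos:
  assumes "k \<in> letters" "Suc k \<in> letters" "\<eta> \<ge> 0"
  shows "moeb (W k) \<eta> > 0"
proof -
  have "k \<noteq> p - 1" using assms by (auto simp: letters_def)
  then have "sn k * \<eta> + sn (real k + 1) > 0"
    using sn_letter[OF assms(1)] assms(3) by (intro add_nonneg_pos) auto
  moreover have "sn (real k - 1) * \<eta> + sn k > 0"
    using wpos_mden[OF wpos_W[OF assms(1)] assms(3)] by (simp add: W_def)
  ultimately show ?thesis by (simp add: W_def)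
qed

text \<open>Read backwards, this is one continued fraction step with digit 1:
  \<open>1 / (lam p - t)\<close> sends the value of \<open>W (Suc k)\<close> to that of
  \<open>W k\<close>.\<close>

lemma moeb_W_Suc:
  assumes "k \<in> letters" "Suc k \<in> letters" "\<eta> \<ge> 0"
  shows "moeb (W (Suc k)) \<eta> = lam p - 1 / moeb (W k) \<eta>"
proof -
  have den: "mden (W k) \<eta> \<noteq> 0" using wpos_mden[OF wpos_W[OF assms(1)] assms(3)] by simp
  have "mden matT (moeb (W k) \<eta>) \<noteq> 0" using W_pos[OF assms] by (simp add: matT_def)
  then have "mden (mmul matT (W k)) \<eta> \<noteq> 0" using den by (simp add: mden_mmul)
  then show ?thesis
    unfolding W_Suc[symmetric] using den by (simp add: moeb_mmul) (simp add: matS_def matT_def)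
qed

lemma moeb_W_1: "moeb (W (Suc 0)) \<eta> = \<eta> + lam p"
  by (simp add: W_1 matS_def)

lemma W_less_lam:
  assumes "m \<in> letters" "m \<noteq> 1" "\<eta> \<ge> 0"
  shows "0 \<le> moeb (W m) \<eta>" "moeb (W m) \<eta> < lam p"
proof -
  show "0 \<le> moeb (W m) \<eta>" using wpos_moeb_nonneg[OF wpos_W[OF assms(1)] assms(3)] .
  obtain k where k: "m = Suc k" "k \<in> letters" using assms by (cases m) (auto simp: letters_def)
  then show "moeb (W m) \<eta> < lam p"
    using W_pos[of k \<eta>] moeb_W_Suc[of k \<eta>] assms by simp
qed

lemma floor_div_lam:
  assumes "0 \<le> t" "t < lam p"
  shows "\<lfloor>(of_int a * lam p + t) / lam p\<rfloor> = a"
proof -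
  have l: "lam p > 0" using lam_ge_1 by simp
  have "(of_int a * lam p + t) / lam p = of_int a + t / lam p"
    using l by (simp add: add_divide_distrib)
  moreover have "0 \<le> t / lam p" "t / lam p < 1" using assms l by auto
  ultimately show ?thesis by linarith
qed

text \<open>The first step removes the translation, and every step lowers the index of the letter by
  one. Values of letters other than \<open>W 1\<close> lie below \<open>lam p\<close>, so the later
  digits in the block are 1.\<close>

lemma cf_x_block:
  assumes m: "m \<in> letters" "m \<noteq> 1" and \<eta>: "\<eta> \<ge> 0" and x: "x = of_int a * lam p + moeb (W m) \<eta>"
    and j: "1 \<le> j" "j < m"
  shows "cf_x p x j = moeb (W (m - j)) \<eta>"
  using j
proof (induction j rule: dec_induct)
  case base
  obtain k where k: "m = Suc k" "k \<in> letters" using m by (cases m) (auto simp: letters_def)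
  have "\<lfloor>x / lam p\<rfloor> = a" unfolding x using W_less_lam[OF m \<eta>] by (rule floor_div_lam)
  then have "cf_x p x 1 = 1 / (lam p - moeb (W m) \<eta>)"
    by (simp add: x algebra_simps)
  also have "lam p - moeb (W m) \<eta> = 1 / moeb (W k) \<eta>"
    using moeb_W_Suc[of k \<eta>] k m \<eta> by simp
  finally show ?case using k by simp
next
  case (step j)
  define k where "k = m - Suc j"
  have k: "m - j = Suc k" "k \<in> letters" "Suc k \<in> letters" "Suc k \<noteq> 1"
    using step m by (auto simp: k_def letters_def)
  have IH: "cf_x p x j = moeb (W (Suc k)) \<eta>" using step k by simp
  have "\<lfloor>cf_x p x j / lam p\<rfloor> = 0"
    using floor_div_lam[OF W_less_lam[OF k(3,4) \<eta>], of 0] IH by simp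
  then have "cf_x p x (Suc j) = 1 / (lam p - moeb (W (Suc k)) \<eta>)" using IH by simp
  also have "lam p - moeb (W (Suc k)) \<eta> = 1 / moeb (W k) \<eta>"
    using moeb_W_Suc[OF k(2,3) \<eta>] by simp
  finally show ?case by (simp add: k_def)
qed

lemma cf_block:
  assumes m: "m \<in> letters" "m \<noteq> 1" and \<eta>: "\<eta> \<ge> 0" and x: "x = of_int a * lam p + moeb (W m) \<eta>"
  shows "cf_r p x 0 = a + 1" "cf_x p x (m - 1) = \<eta> + lam p"
    and "\<And>j. 1 \<le> j \<Longrightarrow> j < m - 1 \<Longrightarrow> cf_x p x j < lam p \<and> cf_r p x j = 1"
proof -
  have m2: "m \<ge> 2" using m by (auto simp: letters_def)
  show "cf_r p x 0 = a + 1"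
    unfolding cf_r_def using floor_div_lam[OF W_less_lam[OF m \<eta>], of a] x by simp
  show "cf_x p x (m - 1) = \<eta> + lam p"
    using cf_x_block[OF m \<eta> x, of "m - 1"] m2 by (simp add: moeb_W_1)
  fix j assume j: "1 \<le> j" "j < m - 1"
  then have "m - j \<in> letters" "m - j \<noteq> 1" using m by (auto simp: letters_def)
  note b = W_less_lam[OF this \<eta>]
  have "cf_x p x j = moeb (W (m - j)) \<eta>" using cf_x_block[OF m \<eta> x, of j] j by simp
  then show "cf_x p x j < lam p \<and> cf_r p x j = 1"
    using floor_div_lam[OF b, of 0] b by (simp add: cf_r_def)
qed

lemma cf_r_ge_2: "x \<ge> lam p \<longleftrightarrow> cf_r p x 0 \<ge> 2"
proof -
  have "lam p > 0" using lam_ge_1 by simp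
  then have "x \<ge> lam p \<longleftrightarrow> 1 \<le> x / lam p" by (simp add: field_simps)
  then show ?thesis by (simp add: cf_r_def le_floor_iff)
qed

text \<open>Take the least \<open>m\<close> such that \<open>W m\<close> at 0 is at most
  \<open>t\<close>. By minimality \<open>t\<close> lies below \<open>W (m - 1)\<close> at 0, which
  is \<open>W m\<close> at infinity, so \<open>t\<close> has a nonnegative preimage.\<close>

lemma moeb_W_surj:
  assumes "0 \<le> t" "t < lam p"
  shows "\<exists>m \<eta>. m \<in> letters \<and> m \<noteq> 1 \<and> \<eta> \<ge> 0 \<and> t = moeb (W m) \<eta>"
proof -
  let ?P = "\<lambda>m. 1 \<le> m \<and> sn (real m + 1) \<le> sn m * t"
  have "?P (p - 1)" using p3 assms sn_diff_p[of 1] by (simp add: of_nat_diff)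
  then obtain m where Pm: "?P m" and min: "\<And>i. i < m \<Longrightarrow> \<not> ?P i"
    using exists_least_iff[of ?P] by blast
  have mp: "m \<le> p - 1" using min[of "p - 1"] \<open>?P (p - 1)\<close> by force
  have m1: "m \<noteq> 1" using Pm sn_rec[of 1] assms by auto
  have m: "m \<in> letters" using Pm mp by (simp add: letters_def)
  have "\<not> ?P (m - 1)" by (rule min) (use Pm in simp)
  moreover have "1 \<le> m - 1" "real (m - 1) = real m - 1" using Pm m1 by linarith+
  ultimately have lt: "sn (real m - 1) * t < sn m" by simp
  \<comment> \<open>The inverse matrix of \<open>W m\<close> applied to \<open>t\<close>.\<close>
  define \<eta> where "\<eta> = (sn m * t - sn (real m + 1)) / (sn m - sn (real m - 1) * t)"
  have "\<eta> \<ge> 0" unfolding \<eta>_def using Pm lt by (intro divide_nonneg_pos) auto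
  let ?den = "sn m - sn (real m - 1) * t"
  have comb: "x * (y / ?den) + z = (x * y + z * ?den) / ?den" for x y z :: real
    using lt by (simp add: add_divide_distrib)
  have "sn m * (sn m * t - sn (real m + 1)) + sn (real m + 1) * ?den
      = (sn m * sn m - sn (real m + 1) * sn (real m - 1)) * t"
    by (simp add: algebra_simps)
  then have num: "sn m * \<eta> + sn (real m + 1) = t / ?den"
    unfolding \<eta>_def comb sn_det by simp
  have "sn (real m - 1) * (sn m * t - sn (real m + 1)) + sn m * ?den
      = sn m * sn m - sn (real m + 1) * sn (real m - 1)"
    by (simp add: algebra_simps)
  then have den: "sn (real m - 1) * \<eta> + sn m = 1 / ?den"
    unfolding \<eta>_def comb sn_det by simp
  have "t = moeb (W m) \<eta>" using lt by (simp add: W_def num den)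
  with m m1 \<open>\<eta> \<ge> 0\<close> show ?thesis by blast
qed

lemma block_decomposition:
  assumes "x \<ge> 0"
  obtains a :: nat and m \<eta> where "m \<in> letters" "m \<noteq> 1" "\<eta> \<ge> 0" "x = real a * lam p + moeb (W m) \<eta>"
proof -
  have l: "lam p > 0" using lam_ge_1 by simp
  define a where "a = \<lfloor>x / lam p\<rfloor>"
  have "a \<ge> 0" using assms l by (simp add: a_def)
  have "of_int a \<le> x / lam p" "x / lam p < of_int a + 1" by (simp_all add: a_def)
  then have "0 \<le> x - of_int a * lam p" "x - of_int a * lam p < lam p"
    using l by (simp_all add: field_simps)
  then obtain m \<eta> where "m \<in> letters" "m \<noteq> 1" "\<eta> \<ge> 0" "x - of_int a * lam p = moeb (W m) \<eta>"
    using moeb_W_surj by blast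
  then show thesis using that[of m \<eta> "nat a"] \<open>a \<ge> 0\<close> by simp
qed

lemma word_replicate_1: "word (replicate a (Suc 0)) = (1, real a * lam p, 0, 1)"
  by (induction a) (simp_all add: mid_def W_1 matS_def algebra_simps)

lemma one_letter: "Suc 0 \<in> letters"
  using p3 by (simp add: letters_def)

lemma replicate_letters: "set (replicate a (Suc 0)) \<subseteq> letters"
  using one_letter by (auto simp: set_replicate_conv_if)

lemma moeb_replicate_1:
  assumes "set v \<subseteq> letters" "x \<ge> 0"
  shows "moeb (word (replicate a (Suc 0) @ v)) x = real a * lam p + moeb (word v) x"
  unfolding moeb_word_append[OF assms] word_replicate_1 by simp

lemma moeb_block:
  assumes "m \<in> letters" "set u \<subseteq> letters" "x \<ge> 0"
  shows "moeb (word (replicate a (Suc 0) @ m # u)) x = real a * lam p + moeb (W m) (moeb (word u) x)"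
proof -
  have "set (m # u) \<subseteq> letters" using assms by simp
  from moeb_replicate_1[OF this assms(3)] show ?thesis unfolding moeb_word_Cons[OF assms(2,3)] .
qed

text \<open>The word splits into blocks, each a run of ones followed by another letter, and
  \<open>cf_block\<close> consumes them in turn. The condition on the last letter ensures that no
  incomplete block remains.\<close>

lemma cf_x_word:
  assumes "set u \<subseteq> letters" "u = [] \<or> last u \<noteq> 1" "\<eta> \<ge> 0"
  shows "\<exists>N. cf_x p (moeb (word u) \<eta> + lam p) N = \<eta> + lam p \<and> (u \<noteq> [] \<longrightarrow> N > 0)"
  using assms
proof (induction "length u" arbitrary: u rule: less_induct)
  case less
  show ?case
  proof (cases "u = []")
    case True
    then show ?thesis by (intro exI[of _ 0]) simp
  next
    case False
    define b where "b = takeWhile (\<lambda>k. k = Suc 0) u"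
    have "dropWhile (\<lambda>k. k = Suc 0) u \<noteq> []"
      using False less.prems(2) last_in_set by (fastforce simp: dropWhile_eq_Nil_conv)
    then obtain m u' where mu: "dropWhile (\<lambda>k. k = Suc 0) u = m # u'" by (meson neq_Nil_conv)
    have "b = replicate (length b) (Suc 0)"
      unfolding b_def by (rule replicate_eqI[OF refl]) (auto dest: set_takeWhileD)
    then obtain a where u: "u = replicate a (Suc 0) @ m # u'"
      using takeWhile_dropWhile_id[of "\<lambda>k. k = Suc 0" u] mu b_def by metis
    have m1: "m \<noteq> 1" using mu hd_dropWhile[of "\<lambda>k. k = Suc 0" u] by auto
    have m: "m \<in> letters" and u': "set u' \<subseteq> letters" using u less.prems(1) by auto
    have "u' = [] \<or> last u' \<noteq> 1" using less.prems(2) u by auto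
    then obtain N where N: "cf_x p (moeb (word u') \<eta> + lam p) N = \<eta> + lam p"
      using less.hyps[of u'] u u' less.prems(3) by auto
    have nn: "moeb (word u') \<eta> \<ge> 0" using u' less.prems(3) by (rule word_nonneg)
    have x: "moeb (word u) \<eta> + lam p = of_int (int a + 1) * lam p + moeb (W m) (moeb (word u') \<eta>)"
      unfolding u using moeb_block[OF m u' less.prems(3), of a] by (simp add: algebra_simps)
    have "cf_x p (moeb (word u) \<eta> + lam p) (m - 1 + N) = \<eta> + lam p"
      unfolding cf_x_add cf_block(2)[OF m m1 nn x] by (rule N)
    moreover have "m - 1 + N > 0" using m m1 by (auto simp: letters_def)
    ultimately show ?thesis by blast
  qed
qed

section \<open>The digits determine the number\<close>

lemma lower_left_block:
  assumes m: "m \<in> letters" "m \<noteq> 1" and u: "set u \<subseteq> letters"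
    and c: "word u = (a,b,c,d)" "word (replicate n (Suc 0) @ m # u) = (a',b',c',d')"
  shows "c' \<ge> c + 1"
proof -
  have wp: "wpos (a,b,c,d)" using wpos_word[OF u] c by simp
  have "c' = sn (real m - 1) * a + sn m * c"
    using c by (simp add: word_append word_replicate_1 W_def)
  moreover have "1 * 1 \<le> sn (real m - 1) * a"
    using sn_letter(4)[OF m(1)] m wp by (intro mult_mono) auto
  moreover have "1 * c \<le> sn m * c"
    using sn_letter(1)[OF m(1)] wp by (intro mult_right_mono) auto
  ultimately show ?thesis by simp
qed

text \<open>Digits show the block boundaries: after its first digit a block has only ones, and the
  next block starts with at least 2. So equal digits give equal blocks, and each block raises the
  lower left entry by at least 1.\<close>

lemma common_prefix:
  assumes "x \<ge> lam p" "y \<ge> lam p" "\<And>j. cf_r p x j = cf_r p y j"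
  shows "\<exists>u a b c d \<xi> \<eta>. set u \<subseteq> letters \<and> \<xi> \<ge> 0 \<and> \<eta> \<ge> 0 \<and> word u = (a,b,c,d) \<and> c \<ge> real n
    \<and> x - lam p = moeb (word u) \<xi> \<and> y - lam p = moeb (word u) \<eta>"
  using assms
proof (induction n arbitrary: x y)
  case 0
  then show ?case
    by (intro exI[of _ "[]"] exI[of _ 1] exI[of _ 0] exI[of _ "x - lam p"] exI[of _ "y - lam p"])
       (simp add: mid_def)
next
  case (Suc n)
  obtain a m \<xi> where m: "m \<in> letters" "m \<noteq> 1" and \<xi>: "\<xi> \<ge> 0" and x: "x - lam p = real a * lam p + moeb (W m) \<xi>"
    using block_decomposition[of "x - lam p"] Suc.prems(1) by (metis diff_ge_0_iff_ge)
  obtain a' m' \<eta> where m': "m' \<in> letters" "m' \<noteq> 1" and \<eta>: "\<eta> \<ge> 0" and y: "y - lam p = real a' * lam p + moeb (W m') \<eta>"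
    using block_decomposition[of "y - lam p"] Suc.prems(2) by (metis diff_ge_0_iff_ge)
  have x': "x = of_int (int a + 1) * lam p + moeb (W m) \<xi>"
    and y': "y = of_int (int a' + 1) * lam p + moeb (W m') \<eta>"
    using x y by (simp_all add: algebra_simps)
  note bx = cf_block[OF m \<xi> x'] and by' = cf_block[OF m' \<eta> y']
  have aa: "a' = a" using bx(1) by'(1) Suc.prems(3)[of 0] by simp
  have shift: "cf_r p (\<xi> + lam p) 0 \<ge> 2" "cf_r p (\<eta> + lam p) 0 \<ge> 2"
    using cf_r_ge_2[of "\<xi> + lam p"] cf_r_ge_2[of "\<eta> + lam p"] \<xi> \<eta> by simp_all
  have rx: "cf_r p x (m - 1 + j) = cf_r p (\<xi> + lam p) j" for j unfolding cf_r_add bx(2) ..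
  have ry: "cf_r p y (m' - 1 + j) = cf_r p (\<eta> + lam p) j" for j unfolding cf_r_add by'(2) ..
  have "m' = m"
  proof (rule linorder_cases[of m m'])
    assume "m < m'"
    then have "cf_r p y (m - 1) = 1" using by'(3)[of "m - 1"] m by (auto simp: letters_def)
    then show ?thesis using shift(1) rx[of 0] Suc.prems(3)[of "m - 1"] by simp
  next
    assume "m' < m"
    then have "cf_r p x (m' - 1) = 1" using bx(3)[of "m' - 1"] m' by (auto simp: letters_def)
    then show ?thesis using shift(2) ry[of 0] Suc.prems(3)[of "m' - 1"] by simp
  qed simp
  have "cf_r p (\<xi> + lam p) j = cf_r p (\<eta> + lam p) j" for j
    using rx[of j] ry[of j] Suc.prems(3) \<open>m' = m\<close> by simp
  then obtain u A B C D \<xi>' \<eta>' where u: "set u \<subseteq> letters" and nn: "\<xi>' \<ge> 0" "\<eta>' \<ge> 0"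
    and M: "word u = (A,B,C,D)" "C \<ge> real n"
    and e: "\<xi> = moeb (word u) \<xi>'" "\<eta> = moeb (word u) \<eta>'"
    using Suc.IH[of "\<xi> + lam p" "\<eta> + lam p"] \<xi> \<eta> by auto
  define w where "w = replicate a (Suc 0) @ m # u"
  obtain A' B' C' D' where M': "word w = (A',B',C',D')" by (cases "word w") auto
  have "C' \<ge> C + 1" using lower_left_block[OF m u M(1) M'[unfolded w_def]] .
  then have "C' \<ge> real (Suc n)" using M by simp
  moreover have "set w \<subseteq> letters" using u m replicate_letters[of a] by (simp add: w_def)
  moreover have "x - lam p = moeb (word w) \<xi>'" "y - lam p = moeb (word w) \<eta>'"
    unfolding w_def moeb_block[OF m(1) u nn(1)] moeb_block[OF m(1) u nn(2)]
    using x y e aa \<open>m' = m\<close> by simp_all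
  ultimately show ?case using M' nn by blast
qed

text \<open>In \<open>wpos_moeb_diff\<close>, \<open>c\<close> times the numerator is at most one
  denominator factor, and the other factor is at least 1. So the half-line has an image of length at
  most \<open>1 / c\<close> when \<open>c > 0\<close>.\<close>

lemma wpos_contraction:
  assumes "wpos (a,b,c,d)" "x \<ge> 0" "y \<ge> 0"
  shows "c * \<bar>moeb (a,b,c,d) x - moeb (a,b,c,d) y\<bar> \<le> 1"
proof -
  have one: "c * (moeb (a,b,c,d) s - moeb (a,b,c,d) t) \<le> 1" if "s \<ge> 0" "t \<ge> 0" for s t
  proof -
    have cd: "c \<ge> 0" "d \<ge> 1" using assms(1) by auto
    have "c * s \<ge> 0" "c * t \<ge> 0" using cd that by auto
    have "c * (s - t) \<le> c * s + d" using \<open>c * t \<ge> 0\<close> cd by (simp add: algebra_simps)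
    also have "\<dots> \<le> (c * s + d) * (c * t + d)"
      using \<open>c * s \<ge> 0\<close> \<open>c * t \<ge> 0\<close> cd mult_left_mono[of 1 "c * t + d" "c * s + d"] by simp
    finally have "c * (s - t) \<le> (c * s + d) * (c * t + d)" .
    moreover have "(c * s + d) * (c * t + d) > 0"
      using \<open>c * s \<ge> 0\<close> \<open>c * t \<ge> 0\<close> cd by (intro mult_pos_pos) auto
    ultimately show ?thesis using wpos_moeb_diff[OF assms(1) that] by simp
  qed
  show ?thesis using one[OF assms(2,3)] one[OF assms(3,2)] by (auto simp: abs_if)
qed

lemma cf_r_inj:
  assumes "x \<ge> lam p" "y \<ge> lam p" "\<And>j. cf_r p x j = cf_r p y j"
  shows "x = y"
proof (rule ccontr)
  assume "x \<noteq> y"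
  then obtain n :: nat where n: "1 < real n * \<bar>x - y\<bar>" using reals_Archimedean3[of "\<bar>x - y\<bar>"] by auto
  obtain u a b c d \<xi> \<eta> where u: "set u \<subseteq> letters" "\<xi> \<ge> 0" "\<eta> \<ge> 0" "word u = (a,b,c,d)" "c \<ge> real n"
    "x - lam p = moeb (word u) \<xi>" "y - lam p = moeb (word u) \<eta>"
    using common_prefix[OF assms, of n] by blast
  have "wpos (a,b,c,d)" using wpos_word[OF u(1)] u(4) by simp
  from wpos_contraction[OF this u(2,3)] have "c * \<bar>x - y\<bar> \<le> 1"
    using u(4,6,7) by (metis diff_diff_eq2 diff_add_cancel)
  moreover have "real n * \<bar>x - y\<bar> \<le> c * \<bar>x - y\<bar>" using u(5) by (intro mult_right_mono) auto
  ultimately show False using n by linarith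
qed

text \<open>\<open>lam p\<close> is itself plus the value of \<open>W (p - 1)\<close> at its fixed
  point 0, so one block of \<open>p - 2\<close> steps returns to it. This identifies the excluded
  period.\<close>

lemma cf_r_lam: "cf_r p (lam p) j = (if j mod (p - 2) = 0 then 2 else 1)"
proof (induction j rule: less_induct)
  case (less j)
  have m: "p - 1 \<in> letters" "p - 1 \<noteq> 1" using p3 by (auto simp: letters_def)
  have x: "lam p = of_int 1 * lam p + moeb (W (p - 1)) 0" unfolding W_last by simp
  note b = cf_block[OF m order_refl x]
  have p2: "p - 1 - 1 = p - 2" by simp
  show ?case
  proof (cases "j < p - 2")
    case True
    then show ?thesis using b(1) b(3)[of j] by (cases "j = 0") auto
  next
    case False
    then obtain i where i: "j = (p - 2) + i" by (metis le_add_diff_inverse linorder_not_less)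
    then have "i < j" using p3 by simp
    have "cf_r p (lam p) j = cf_r p (lam p) i" using b(2) unfolding i cf_r_add p2 by simp
    then show ?thesis using less.IH[OF \<open>i < j\<close>] i by simp
  qed
qed

section \<open>Reduced numbers and simple numbers\<close>

lemma cf_x_return_word:
  assumes "k > 0" "x \<ge> lam p" "cf_x p x k \<ge> lam p"
  shows "\<exists>(a::nat) v. set v \<subseteq> letters \<and> v \<noteq> [] \<and> \<lfloor>x / lam p\<rfloor> = int a + 1
    \<and> x - lam p = moeb (word (replicate a (Suc 0) @ v)) (cf_x p x k - lam p)"
  using assms
proof (induction k arbitrary: x rule: less_induct)
  case (less k)
  obtain a m \<eta> where m: "m \<in> letters" "m \<noteq> 1" and \<eta>: "\<eta> \<ge> 0" and x: "x - lam p = real a * lam p + moeb (W m) \<eta>"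
    using block_decomposition[of "x - lam p"] less.prems(2) by (metis diff_ge_0_iff_ge)
  have x': "x = of_int (int a + 1) * lam p + moeb (W m) \<eta>"
    using x by (simp add: algebra_simps)
  note b = cf_block[OF m \<eta> x']
  have fl: "\<lfloor>x / lam p\<rfloor> = int a + 1" using b(1) by (simp add: cf_r_def)
  let ?y = "cf_x p x k"
  have y: "?y - lam p \<ge> 0" using less.prems by simp
  \<comment> \<open>Values strictly inside a block are below \<open>lam p\<close>, so the return
    cannot happen before the block ends.\<close>
  have "\<not> k < m - 1" using b(3)[of k] less.prems by auto
  then obtain i where i: "k = (m - 1) + i" by (metis le_add_diff_inverse linorder_not_less)
  have yi: "?y = cf_x p (\<eta> + lam p) i" unfolding i cf_x_add b(2) ..
  have "\<exists>u. set u \<subseteq> letters \<and> \<eta> = moeb (word u) (?y - lam p)"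
  proof (cases "i = 0")
    case True
    then show ?thesis using yi by (intro exI[of _ "[]"]) simp
  next
    case False
    have "i < k" using i m by (auto simp: letters_def)
    then obtain a' v where "set v \<subseteq> letters" "\<eta> = moeb (word (replicate a' (Suc 0) @ v)) (?y - lam p)"
      using less.IH[of i "\<eta> + lam p"] False \<eta> yi less.prems(3) by auto
    then show ?thesis using replicate_letters by (intro exI[of _ "replicate a' (Suc 0) @ v"]) simp
  qed
  then obtain u where u: "set u \<subseteq> letters" "\<eta> = moeb (word u) (?y - lam p)" by blast
  have "x - lam p = moeb (word (replicate a (Suc 0) @ m # u)) (?y - lam p)"
    unfolding moeb_block[OF m(1) u(1) y] u(2)[symmetric] by (rule x)
  then show ?case using fl m u(1) by (intro exI[of _ a] exI[of _ "m # u"]) auto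
qed

lemma simple_number_if_reduced:
  assumes red: "Gp_reduced p \<beta>" and i: "1 \<le> i" "i \<le> \<lfloor>\<beta> / lam p\<rfloor>"
  shows "Gp_simple_number p (\<beta> - of_int i * lam p)"
proof -
  obtain k where k: "k > 0" "\<And>j. cf_r p \<beta> (j + k) = cf_r p \<beta> j"
    and excl: "\<not> (\<forall>j. cf_r p \<beta> j = (if j mod (p - 2) = 0 then 2 else 1))"
    using red unfolding Gp_reduced_def by blast
  have \<beta>: "\<beta> \<ge> lam p" unfolding cf_r_ge_2 using i by (simp add: cf_r_def del: one_le_floor)
  have "\<beta> \<noteq> lam p" using excl cf_r_lam by metis
  have same: "cf_r p (cf_x p \<beta> k) j = cf_r p \<beta> j" for j
    using k(2)[of j] cf_r_add[of p \<beta> k j] by (simp add: add.commute)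
  then have "cf_x p \<beta> k \<ge> lam p" using \<beta> unfolding cf_r_ge_2 by simp
  \<comment> \<open>Only the digits are assumed periodic; injectivity makes \<open>\<beta>\<close>
    itself return.\<close>
  then have per: "cf_x p \<beta> k = \<beta>" using cf_r_inj[OF _ \<beta> same] by blast
  define \<xi> where "\<xi> = \<beta> - lam p"
  have \<xi>: "\<xi> > 0" using \<beta> \<open>\<beta> \<noteq> lam p\<close> by (simp add: \<xi>_def)
  obtain a :: nat and v where v: "set v \<subseteq> letters" "v \<noteq> []" and a: "\<lfloor>\<beta> / lam p\<rfloor> = int a + 1"
    and \<xi>v: "\<xi> = moeb (word (replicate a (Suc 0) @ v)) \<xi>"
    using cf_x_return_word[OF k(1) \<beta>] \<beta> unfolding per \<xi>_def by blast
  \<comment> \<open>One \<open>lam p\<close> is already removed in \<open>\<xi>\<close>, so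
    \<open>i - 1\<close> of the leading letters 1 remain to be moved; the bound on \<open>i\<close>
    says that the word starts with at least that many.\<close>
  define n where "n = nat (i - 1)"
  have n: "n \<le> a" "of_int i = real n + 1" using i a by (auto simp: n_def)
  define v' where "v' = replicate (a - n) (Suc 0) @ v"
  have v': "set v' \<subseteq> letters" "v' \<noteq> []" using v replicate_letters[of "a - n"] by (auto simp: v'_def)
  have "replicate a (Suc 0) @ v = replicate n (Suc 0) @ v'"
    using n by (simp add: v'_def replicate_add[symmetric] flip: append_assoc)
  then have \<xi>n: "\<xi> = real n * lam p + moeb (word v') \<xi>"
    using \<xi>v moeb_replicate_1[OF v'(1), of \<xi> n] \<xi> by simp
  define \<alpha> where "\<alpha> = moeb (word v') \<xi>"
  have \<alpha>: "\<alpha> > 0" unfolding \<alpha>_def using v'(1) \<xi> by (rule word_pos)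
  have "moeb (word (replicate n (Suc 0))) \<alpha> = \<xi>" using \<xi>n by (simp add: word_replicate_1 \<alpha>_def)
  \<comment> \<open>The moved letters take \<open>\<alpha>\<close> to \<open>\<xi>\<close>, and
    \<open>v'\<close> takes \<open>\<xi>\<close> back to \<open>\<alpha>\<close>.\<close>
  then have "moeb (word (v' @ replicate n (Suc 0))) \<alpha> = \<alpha>"
    using moeb_word_append[OF replicate_letters, of \<alpha> v' n] \<alpha> by (simp add: \<alpha>_def)
  then have "Gp_simple_number p \<alpha>"
    using simple_number_if_word[of "v' @ replicate n (Suc 0)" \<alpha>] v' \<alpha> replicate_letters[of n] by simp
  moreover have "\<beta> - of_int i * lam p = \<alpha>" using \<xi>n n(2) by (simp add: \<alpha>_def \<xi>_def algebra_simps)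
  ultimately show ?thesis by simp
qed

lemma strip_trailing_ones:
  "\<exists>v j. w = v @ replicate j (Suc 0) \<and> (v = [] \<or> last v \<noteq> 1)"
proof (induction w rule: rev_induct)
  case (snoc k w)
  show ?case
  proof (cases "k = Suc 0")
    case True
    obtain v j where "w = v @ replicate j (Suc 0)" "v = [] \<or> last v \<noteq> 1" using snoc by blast
    then show ?thesis using True by (intro exI[of _ v] exI[of _ "Suc j"]) (simp add: replicate_append_same)
  next
    case False
    then show ?thesis by (intro exI[of _ "w @ [k]"] exI[of _ 0]) simp
  qed
qed simp

text \<open>The pole \<open>- d / c\<close> lies at or above \<open>- lam p\<close>, because the
  recurrence for \<open>sn\<close> writes \<open>lam p * c - d\<close> as a sum of nonnegative
  terms.\<close>

lemma lower_row_last: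
  assumes v: "set v \<subseteq> letters" "v \<noteq> []" "last v \<noteq> 1" and M: "word v = (a,b,c,d)"
  shows "c > 0" "d \<le> lam p * c"
proof -
  define m where "m = last v"
  obtain u where u: "v = u @ [m]" using v(2) by (metis append_butlast_last_id m_def)
  have m: "m \<in> letters" "m \<noteq> 1" using v last_in_set[of v] by (auto simp: m_def)
  have ul: "set u \<subseteq> letters" using v(1) unfolding u by simp
  obtain A B C D where Mu: "word u = (A,B,C,D)" by (cases "word u") auto
  have pos: "C \<ge> 0" "D \<ge> 1" using wpos_word[OF ul] Mu by auto
  have c: "c = C * sn m + D * sn (real m - 1)" and d: "d = C * sn (real m + 1) + D * sn m"
    using M unfolding u by (simp_all add: word_append Mu W_def)
  have "sn m \<ge> 1" "sn (real m - 1) \<ge> 1" using sn_letter[OF m(1)] m(2) by auto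
  then have "D * sn (real m - 1) > 0" "C * sn m \<ge> 0" "C * sn (real m - 1) \<ge> 0" using pos by simp_all
  then show "c > 0" unfolding c by linarith
  have "lam p * c - d = C * sn (real m - 1) + D * sn (real m - 2)"
  proof -
    have e: "sn (real m - 1) = lam p * sn m - sn (real m + 1)"
      "sn (real m - 2) = lam p * sn (real m - 1) - sn m"
      using sn_rec[of m] sn_rec[of "real m - 1"] by simp_all
    have "lam p * c - d = C * (lam p * sn m - sn (real m + 1)) + D * (lam p * sn (real m - 1) - sn m)"
      unfolding c d by (simp add: algebra_simps)
    then show ?thesis unfolding e[symmetric] .
  qed
  moreover have "sn (real m - 2) \<ge> 0"
    using m by (intro sn_nonneg) (auto simp: letters_def)
  then have "D * sn (real m - 2) \<ge> 0" using pos by simp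
  ultimately show "d \<le> lam p * c" using \<open>C * sn (real m - 1) \<ge> 0\<close> by linarith
qed

text \<open>Let \<open>w\<close> be \<open>v\<close> followed by \<open>j\<close> letters 1. The
  pole of \<open>v\<close> places the conjugate plus \<open>j * lam p\<close> strictly between
  \<open>- lam p\<close> and 0, so \<open>n = j + 1\<close>. Moving the ones to the front gives a
  word fixing \<open>\<alpha> + j * lam p\<close> that does not end in 1.\<close>

lemma reduced_if_simple_number:
  assumes "Gp_simple_number p \<alpha>"
  shows "\<exists>n::nat. \<alpha> > 0 \<and> n \<ge> 1 \<and> \<lfloor>hecke_conj p \<alpha> / lam p\<rfloor> = - int n \<and> Gp_reduced p (\<alpha> + real n * lam p)"
proof -
  have l: "lam p > 0" using lam_ge_1 by simp
  obtain w where \<alpha>: "\<alpha> > 0" and w: "set w \<subseteq> letters" "w \<noteq> []" "moeb (word w) \<alpha> = \<alpha>"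
    using word_if_simple_number[OF assms] by blast
  obtain a b c d where M: "word w = (a,b,c,d)" by (cases "word w") auto
  have c: "c > 0" using word_fixing_entries[OF w(1,2) \<alpha> w(3) M] by simp
  obtain v j where wv: "w = v @ replicate j (Suc 0)" and v1: "v = [] \<or> last v \<noteq> 1"
    using strip_trailing_ones by blast
  have "v \<noteq> []" using c M wv by (auto simp: word_replicate_1)
  have v: "set v \<subseteq> letters" using w(1) wv by simp
  obtain a0 b0 c0 d0 where Mv: "word v = (a0,b0,c0,d0)" by (cases "word v") auto
  have d: "d = c * (real j * lam p) + d0" and c0: "c0 = c"
    using M unfolding wv by (auto simp: word_append word_replicate_1 Mv)
  have d0: "d0 \<le> lam p * c" "d0 \<ge> 1"
    using lower_row_last[OF v \<open>v \<noteq> []\<close> _ Mv] v1 \<open>v \<noteq> []\<close> wpos_word[OF v] Mv c0 by auto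
  define \<alpha>' where "\<alpha>' = (a - d) / c - \<alpha>"
  have conj: "hecke_conj p \<alpha> = \<alpha>'" unfolding \<alpha>'_def by (rule hecke_conj_word[OF w(1,2) \<alpha> w(3) M])
  have wp: "wpos (a,b,c,d)" using wpos_word[OF w(1)] M by simp
  have "fixes_pt (a,b,c,d) \<alpha>" using word_fixes_pt[OF w(1), of \<alpha>] w(3) \<alpha> M by simp
  then have inv: "(a - c*\<alpha>) * (c*\<alpha> + d) = 1" using fixes_pt_inverse[of a b c d \<alpha>] wp by (simp del: fixes_pt.simps)
  have "c * \<alpha> > 0" using c \<alpha> by simp
  then have gt1: "c*\<alpha> + d > 1" using wp by simp
  then have "a - c*\<alpha> = 1 / (c*\<alpha> + d)" using inv by (simp add: eq_divide_eq)
  \<comment> \<open>The second eigenvalue is the reciprocal of one above 1. It lies below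
    \<open>d0\<close>, which fixes the sign of the shifted conjugate.\<close>
  then have small: "a - c*\<alpha> > 0" "a - c*\<alpha> < 1" using gt1 by simp_all
  have \<alpha>'j: "\<alpha>' + real j * lam p = (a - c*\<alpha> - d0) / c"
    unfolding \<alpha>'_def d using c by (simp add: field_simps)
  have "(a - c*\<alpha> - d0) / c < 0" using small d0 c by (intro divide_neg_pos) auto
  moreover have "- lam p * c < a - c*\<alpha> - d0" using small d0 by (simp add: algebra_simps)
  then have "- lam p < (a - c*\<alpha> - d0) / c" using c by (simp add: pos_less_divide_eq)
  \<comment> \<open>One further \<open>lam p\<close> moves the value into the range that
    \<open>floor_div_lam\<close> requires.\<close>
  ultimately have "0 \<le> \<alpha>' + (real j + 1) * lam p" "\<alpha>' + (real j + 1) * lam p < lam p"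
    using \<alpha>'j by (simp_all add: algebra_simps)
  from floor_div_lam[OF this, of "- (int j + 1)"]
  have fl: "\<lfloor>\<alpha>' / lam p\<rfloor> = - int (Suc j)" by (simp add: algebra_simps)
  define \<xi> where "\<xi> = \<alpha> + real j * lam p"
  have \<xi>: "\<xi> > 0" using \<alpha> l by (simp add: \<xi>_def add_pos_nonneg)
  have j\<alpha>: "moeb (word (replicate j (Suc 0))) \<alpha> = \<xi>" by (simp add: word_replicate_1 \<xi>_def)
  then have v\<xi>: "moeb (word v) \<xi> = \<alpha>"
    using w(3) moeb_word_append[OF replicate_letters, of \<alpha> v j] \<alpha> wv by simp
  define u where "u = replicate j (Suc 0) @ v"
  have u: "set u \<subseteq> letters" "u \<noteq> []" "last u \<noteq> 1"
    using v \<open>v \<noteq> []\<close> v1 replicate_letters[of j] by (auto simp: u_def)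
  have u\<xi>: "moeb (word u) \<xi> = \<xi>"
    unfolding u_def using moeb_replicate_1[OF v, of \<xi> j] \<xi> v\<xi> by (simp add: \<xi>_def)
  define \<beta> where "\<beta> = \<xi> + lam p"
  obtain N where N: "cf_x p \<beta> N = \<beta>" "N > 0"
    using cf_x_word[OF u(1), of \<xi>] u \<xi> u\<xi> by (auto simp: \<beta>_def)
  have "cf_r p \<beta> (i + N) = cf_r p \<beta> i" for i
    using cf_r_add[of p \<beta> N i] N(1) by (simp add: add.commute)
  moreover have "\<not> (\<forall>i. cf_r p \<beta> i = (if i mod (p - 2) = 0 then 2 else 1))"
  proof
    assume "\<forall>i. cf_r p \<beta> i = (if i mod (p - 2) = 0 then 2 else 1)"
    then have "\<beta> = lam p" using \<xi> by (intro cf_r_inj) (simp_all add: \<beta>_def cf_r_lam)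
    then show False using \<xi> by (simp add: \<beta>_def)
  qed
  ultimately have "Gp_reduced p \<beta>" unfolding Gp_reduced_def using N(2) by blast
  moreover have "\<beta> = \<alpha> + real (Suc j) * lam p" by (simp add: \<beta>_def \<xi>_def algebra_simps)
  ultimately show ?thesis using \<alpha> fl conj by (intro exI[of _ "Suc j"]) simp
qed

end

theorem theorem6p2:
  fixes p :: nat
  assumes "p \<ge> 3"
  shows "(\<forall>\<alpha>. Gp_simple_number p \<alpha> \<longrightarrow>
            Gp_reduced p (\<alpha> + of_int (- \<lfloor>hecke_conj p \<alpha> / lam p\<rfloor>) * lam p))
       \<and> {\<alpha>. Gp_simple_number p \<alpha>} =
         {\<beta> - of_int i * lam p | \<beta> i. Gp_reduced p \<beta> \<and> 1 \<le> i \<and> i \<le> \<lfloor>\<beta> / lam p\<rfloor>}"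
proof -
  interpret hecke p by unfold_locales (rule assms)
  have "Gp_reduced p (\<alpha> + of_int (- \<lfloor>hecke_conj p \<alpha> / lam p\<rfloor>) * lam p)"
    if "Gp_simple_number p \<alpha>" for \<alpha>
    using reduced_if_simple_number[OF that] by auto
  moreover have "\<exists>\<beta> i. \<alpha> = \<beta> - of_int i * lam p \<and> Gp_reduced p \<beta> \<and> 1 \<le> i \<and> i \<le> \<lfloor>\<beta> / lam p\<rfloor>"
    if \<alpha>: "Gp_simple_number p \<alpha>" for \<alpha>
  proof -
    obtain n :: nat where n: "\<alpha> > 0" "n \<ge> 1" "Gp_reduced p (\<alpha> + real n * lam p)"
      using reduced_if_simple_number[OF \<alpha>] by blast
    \<comment> \<open>Positivity of \<open>\<alpha>\<close> makes \<open>n\<close> an admissible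
      index \<open>i\<close>.\<close>
    have "real n \<le> (\<alpha> + real n * lam p) / lam p"
      using n lam_ge_1 by (simp add: pos_le_divide_eq)
    then have "int n \<le> \<lfloor>(\<alpha> + real n * lam p) / lam p\<rfloor>" by (simp add: le_floor_iff)
    with n show ?thesis by (intro exI[of _ "\<alpha> + real n * lam p"] exI[of _ "int n"]) simp
  qed
  ultimately show ?thesis using simple_number_if_reduced by blast
qed

end
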